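(* Let $B=(\beta_1,\beta_2,\dots,\beta_p)$ be an alternate base and let $\delta=\prod_{i=1}^p\beta_i$. 1. If $B$ satisfies Property (PF), then $\delta$ is a Pisot number or a Salem number, and $\beta_i\in\mathbb{Q}(\delta)$ for every $i\in\{1,\dots,p\}$. 2. If, moreover, $B$ satisfies Property (F), then $B$ is a simple Parry alternate base, and for any non-identical embedding $\psi$ of $\mathbb{Q}(\delta)$ into $\mathbb{C}$ the vector $(\psi(\beta_1),\dots,\psi(\beta_p))$ is not positive.
   Context: $\mathbb{N}$ contains $0$. An alternate base with period $p\ge 1$, written $B=(\beta_1,\dots,\beta_p)$, is a purely periodic sequence $(\beta_n)_{n\ge1}$ of real numbers $\beta_n>1$ with $\beta_{n+p}=\beta_n$ for all $n$. For $k\ge1$, $B^{(k)}=(\beta_n)_{n\ge k}$ is the shifted base. Greedy expansion: for $x\in[0,1]$ put $x_1=\lfloor\beta_1x\rfloor$, $r_1=\beta_1x-x_1$, and for $n\ge2$ put $x_n=\lfloor\beta_nr_{n-1}\rfloor$, $r_n=\beta_nr_{n-1}-x_n$; the sequence $d_B(x)=x_1x_2x_3\cdots$ is the $B$-expansion of $x$, and $x=\sum_{n\ge1}x_n/(\beta_1\cdots\beta_n)$. In particular this defines $d_B(1)$. The expansion $d_{B^{(k)}}$ is defined in the same way using the base sequence $B^{(k)}$. $\mathcal{F}$ is the set of sequences $(x_n)_{n\ge1}$ of non-negative integers with only finitely many nonzero terms, and $\mathrm{Fin}(B)=\{x\in[0,1): d_B(x)\in\mathcal{F}\}$. Property (PF):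 for all $x,y\in\mathrm{Fin}(B)$, $x+y\in[0,1)$ implies $x+y\in\mathrm{Fin}(B)$. Property (F): for all $x,y\in\mathrm{Fin}(B)$, $x+y\in[0,1)$ implies $x+y\in\mathrm{Fin}(B)$, and $x-y\in[0,1)$ implies $x-y\in\mathrm{Fin}(B)$. $B$ is a simple Parry alternate base if $d_{B^{(\ell)}}(1)\in\mathcal{F}$ for every $\ell\in\{1,\dots,p\}$. An algebraic integer $\delta>1$ is a Pisot number if all its conjugates other than $\delta$ lie in the interior of the unit disc (so rational integers $\geq 2$ are Pisot numbers); it is a Salem number if all its conjugates other than $\delta$ lie in the closed unit disc and at least one lies on its boundary. The embeddings of $\mathbb{Q}(\delta)$ into $\mathbb{C}$ are the field isomorphisms $\psi:\mathbb{Q}(\delta)\to\mathbb{Q}(\gamma)$ with $\psi(\delta)=\gamma$, $\gamma$ a conjugate of $\delta$; non-identical means $\gamma\ne\delta$. A vector is positive if all its components are positive real numbers. *)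

theory Defs
  imports "HOL-Analysis.Analysis" "HOL-Computational_Algebra.Computational_Algebra"
begin

text \<open>
  Sequences \<open>(s\<^sub>n)\<close> with \<open>n \<ge> 1\<close> are functions on \<open>nat\<close> whose value at \<open>0\<close> is irrelevant.
\<close>

definition alternate_base :: "nat \<Rightarrow> (nat \<Rightarrow> real) \<Rightarrow> bool" where
  "alternate_base p \<beta> \<longleftrightarrow> p \<ge> 1 \<and> (\<forall>n\<ge>1. \<beta> n > 1 \<and> \<beta> (n + p) = \<beta> n)"

text \<open>\<open>shifted_base \<beta> k\<close> is the re-indexed sequence \<open>\<beta>\<^sub>k, \<beta>\<^sub>k\<^sub>+\<^sub>1, \<dots>\<close>, meant for \<open>k \<ge> 1\<close>.\<close>

definition shifted_base :: "(nat \<Rightarrow> real) \<Rightarrow> nat \<Rightarrow> nat \<Rightarrow> real" where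
  "shifted_base \<beta> k n = \<beta> (n + k - 1)"

text \<open>The start value \<open>r\<^sub>0 = x\<close> merges the first step of the greedy algorithm with the later ones.\<close>

fun greedy_remainder :: "(nat \<Rightarrow> real) \<Rightarrow> real \<Rightarrow> nat \<Rightarrow> real" where
  "greedy_remainder \<beta> x 0 = x"
| "greedy_remainder \<beta> x (Suc n) =
     \<beta> (Suc n) * greedy_remainder \<beta> x n
       - of_int \<lfloor>\<beta> (Suc n) * greedy_remainder \<beta> x n\<rfloor>"

definition greedy_expansion :: "(nat \<Rightarrow> real) \<Rightarrow> real \<Rightarrow> nat \<Rightarrow> int" where
  "greedy_expansion \<beta> x n = \<lfloor>\<beta> n * greedy_remainder \<beta> x (n - 1)\<rfloor>"

definition finite_digit_seqs :: "(nat \<Rightarrow> int) set" where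
  "finite_digit_seqs = {s. (\<forall>n\<ge>1. s n \<ge> 0) \<and> finite {n. n \<ge> 1 \<and> s n \<noteq> 0}}"

definition Fin_base :: "(nat \<Rightarrow> real) \<Rightarrow> real set" where
  "Fin_base \<beta> = {x \<in> {0..<1}. greedy_expansion \<beta> x \<in> finite_digit_seqs}"

definition property_PF :: "(nat \<Rightarrow> real) \<Rightarrow> bool" where
  "property_PF \<beta> \<longleftrightarrow>
     (\<forall>x\<in>Fin_base \<beta>. \<forall>y\<in>Fin_base \<beta>. x + y \<in> {0..<1} \<longrightarrow> x + y \<in> Fin_base \<beta>)"

definition property_F :: "(nat \<Rightarrow> real) \<Rightarrow> bool" where
  "property_F \<beta> \<longleftrightarrow>
     (\<forall>x\<in>Fin_base \<beta>. \<forall>y\<in>Fin_base \<beta>.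
        (x + y \<in> {0..<1} \<longrightarrow> x + y \<in> Fin_base \<beta>) \<and>
        (x - y \<in> {0..<1} \<longrightarrow> x - y \<in> Fin_base \<beta>))"

definition simple_Parry_base :: "nat \<Rightarrow> (nat \<Rightarrow> real) \<Rightarrow> bool" where
  "simple_Parry_base p \<beta> \<longleftrightarrow>
     (\<forall>l\<in>{1..p}. greedy_expansion (shifted_base \<beta> l) 1 \<in> finite_digit_seqs)"

definition is_minimal_poly :: "rat poly \<Rightarrow> 'a::field_char_0 \<Rightarrow> bool" where
  "is_minimal_poly q x \<longleftrightarrow> lead_coeff q = 1 \<and> irreducible q \<and> poly (map_poly of_rat q) x = 0"

text \<open>A number counts as a conjugate of itself.\<close>

definition Galois_conjugate :: "real \<Rightarrow> complex \<Rightarrow> bool" where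
  "Galois_conjugate \<delta> \<gamma> \<longleftrightarrow> (\<exists>q. is_minimal_poly q \<delta> \<and> is_minimal_poly q \<gamma>)"

definition Pisot_number :: "real \<Rightarrow> bool" where
  "Pisot_number \<delta> \<longleftrightarrow> algebraic_int \<delta> \<and> \<delta> > 1 \<and>
     (\<forall>\<gamma>. Galois_conjugate \<delta> \<gamma> \<and> \<gamma> \<noteq> complex_of_real \<delta> \<longrightarrow> cmod \<gamma> < 1)"

definition Salem_number :: "real \<Rightarrow> bool" where
  "Salem_number \<delta> \<longleftrightarrow> algebraic_int \<delta> \<and> \<delta> > 1 \<and>
     (\<forall>\<gamma>. Galois_conjugate \<delta> \<gamma> \<and> \<gamma> \<noteq> complex_of_real \<delta> \<longrightarrow> cmod \<gamma> \<le> 1) \<and>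
     (\<exists>\<gamma>. Galois_conjugate \<delta> \<gamma> \<and> \<gamma> \<noteq> complex_of_real \<delta> \<and> cmod \<gamma> = 1)"

text \<open>Closure under \<open>inverse\<close> needs no side condition, since \<open>inverse 0 = 0\<close>.\<close>

definition is_subfield :: "'a::field set \<Rightarrow> bool" where
  "is_subfield K \<longleftrightarrow> 0 \<in> K \<and> 1 \<in> K \<and>
     (\<forall>x\<in>K. \<forall>y\<in>K. x + y \<in> K \<and> x * y \<in> K) \<and> (\<forall>x\<in>K. - x \<in> K \<and> inverse x \<in> K)"

text \<open>In characteristic \<open>0\<close> every subfield contains the rationals, so this is \<open>\<rat>(x)\<close>.\<close>

definition rat_adjoin :: "'a::field_char_0 \<Rightarrow> 'a set" where
  "rat_adjoin x = is_subfield hull {x}"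

definition field_iso_on :: "('a::field \<Rightarrow> 'b::field) \<Rightarrow> 'a set \<Rightarrow> 'b set \<Rightarrow> bool" where
  "field_iso_on \<psi> K L \<longleftrightarrow> bij_betw \<psi> K L \<and> \<psi> 1 = 1 \<and>
     (\<forall>x\<in>K. \<forall>y\<in>K. \<psi> (x + y) = \<psi> x + \<psi> y \<and> \<psi> (x * y) = \<psi> x * \<psi> y)"

text \<open>An embedding is a total function of which only the values on \<open>\<rat>(\<delta>)\<close> matter.\<close>

definition embedding_of :: "real \<Rightarrow> (real \<Rightarrow> complex) \<Rightarrow> bool" where
  "embedding_of \<delta> \<psi> \<longleftrightarrow>
     (\<exists>\<gamma>. Galois_conjugate \<delta> \<gamma> \<and> \<psi> \<delta> = \<gamma> \<and> field_iso_on \<psi> (rat_adjoin \<delta>) (rat_adjoin \<gamma>))"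

definition positive_vector :: "nat \<Rightarrow> (nat \<Rightarrow> complex) \<Rightarrow> bool" where
  "positive_vector p v \<longleftrightarrow> (\<forall>i\<in>{1..p}. \<exists>r>0. v i = complex_of_real r)"

end

theory Submission
  imports Defs "Jordan_Normal_Form.Char_Poly" "HOL-Computational_Algebra.Field_as_Ring"
begin

text \<open>
  Let \<open>w\<^sub>n = 1/(\<beta>\<^sub>1 \<cdots> \<beta>\<^sub>n)\<close> be the weight of the \<open>n\<close>-th digit, so that \<open>w\<^sub>n\<^sub>+\<^sub>p = w\<^sub>n/\<delta>\<close>.

  Property (PF) is used only through integer relations between the weights. Every multiple \<open>N w\<^sub>n < 1\<close>
  is a sum of copies of \<open>w\<^sub>n\<close> and therefore has a finite expansion. Take \<open>n\<close> large compared to \<open>i\<close> and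
  \<open>N\<close> least with \<open>N w\<^sub>n \<ge> w\<^sub>i\<close>: the greedy algorithm then produces the digit \<open>1\<close> at position \<open>i\<close>, only zeros
  at the other positions up to \<open>n\<close>, and afterwards a finite tail, so
  \<open>N w\<^sub>n = w\<^sub>i + x\<^sub>n\<^sub>+\<^sub>1 w\<^sub>n\<^sub>+\<^sub>1 + \<cdots> + x\<^sub>M w\<^sub>M\<close> (lemma \<open>leading_digit_expansion\<close>). Everything in the first part
  follows from this family of relations.

  \<^item> Each weight is an integer combination of later ones. Hence \<open>w\<^sub>1, \<dots>, w\<^sub>p\<^sub>+\<^sub>L\<close> all lie in the group
  generated by the window \<open>w\<^sub>p\<^sub>+\<^sub>1, \<dots>, w\<^sub>p\<^sub>+\<^sub>L\<close> once \<open>L\<close> is large, and multiplication by \<open>\<delta>\<close>, which shifts the index by \<open>-p\<close>, acts on this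
  window by an integer matrix. So \<open>\<delta>\<close> is an eigenvalue of an integer matrix and an algebraic integer.

  \<^item> Let \<open>(v\<^sub>n)\<close> be complex numbers that satisfy all integer relations of the weights and
  \<open>v\<^sub>n\<^sub>+\<^sub>p = v\<^sub>n/\<gamma>\<close> with \<open>|\<gamma>| > 1\<close>. In the relation above with \<open>n = kp\<close> the tail is at most \<open>w\<^sub>n = \<delta>\<^sup>-\<^sup>k\<close>, and
  the corresponding tail for \<open>v\<close> is at most a constant times \<open>|\<gamma>|\<^sup>-\<^sup>k\<close>. Eliminating \<open>N\<close> shows
  that \<open>v\<^sub>i \<gamma>\<^sup>k - w\<^sub>i v\<^sub>0 \<delta>\<^sup>k\<close> stays bounded as \<open>k\<close> grows (lemma \<open>leading_terms_agree\<close>).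

  This comparison is used twice. If \<open>\<gamma> = \<delta>\<close>, it forces \<open>v\<^sub>i = w\<^sub>i v\<^sub>0\<close>; applied to \<open>v\<^sub>n = \<phi>(w\<^sub>n)\<close> for a
  \<open>\<rat>(\<delta>)\<close>-linear \<open>\<phi>\<close> with \<open>\<phi>(1) = 0\<close> it says that no such \<open>\<phi>\<close> separates \<open>w\<^sub>i\<close> from \<open>\<rat>(\<delta>)\<close>, so
  \<open>w\<^sub>i \<in> \<rat>(\<delta>)\<close>, and the \<open>\<beta>\<^sub>i\<close> are quotients of weights. If \<open>\<gamma>\<close> is a conjugate of \<open>\<delta>\<close> outside the
  closed unit disc, apply it to the conjugates \<open>v\<^sub>n\<close> of \<open>w\<^sub>n\<close> and \<open>i = p\<close>: then \<open>\<gamma>\<^sup>k - \<delta>\<^sup>k\<close> is bounded, which is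
  possible only for \<open>\<gamma> = \<delta>\<close>. So all other conjugates lie in the closed disc, and \<open>\<delta>\<close> is Pisot or Salem.

  Under Property (F) one may also subtract. The number \<open>w\<^sub>n - \<lfloor>\<beta>\<^sub>n\<^sub>+\<^sub>1\<rfloor> w\<^sub>n\<^sub>+\<^sub>1\<close> has a finite expansion, and after
  position \<open>n + 1\<close> the greedy algorithm runs on it exactly as after the first step on \<open>1\<close> in the base that
  starts with \<open>\<beta>\<^sub>n\<^sub>+\<^sub>1\<close>; so (F) implies the simple Parry property. Finally,
  \<open>w\<^sub>p - w\<^sub>2\<^sub>p > 0\<close> is a sum of weights; if an embedding \<open>\<psi>\<close> made all \<open>\<psi>(\<beta>\<^sub>i)\<close> positive, the image
  \<open>\<psi>(w\<^sub>2\<^sub>p)(\<psi>(\<delta>) - 1)\<close> would be a nonempty sum of positive numbers, whereas \<open>0 < \<psi>(\<delta>) \<le> 1\<close>.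
\<close>

section \<open>Subfields and rational polynomials\<close>

lemma is_subfield_0: "is_subfield K \<Longrightarrow> 0 \<in> K"
  by (simp add: is_subfield_def)

lemma is_subfield_1: "is_subfield K \<Longrightarrow> 1 \<in> K"
  by (simp add: is_subfield_def)

lemma is_subfield_add: "is_subfield K \<Longrightarrow> x \<in> K \<Longrightarrow> y \<in> K \<Longrightarrow> x + y \<in> K"
  by (simp add: is_subfield_def)

lemma is_subfield_mult: "is_subfield K \<Longrightarrow> x \<in> K \<Longrightarrow> y \<in> K \<Longrightarrow> x * y \<in> K"
  by (simp add: is_subfield_def)

lemma is_subfield_neg: "is_subfield K \<Longrightarrow> x \<in> K \<Longrightarrow> - x \<in> K"
  by (simp add: is_subfield_def)

lemma is_subfield_inverse: "is_subfield K \<Longrightarrow> x \<in> K \<Longrightarrow> inverse x \<in> K"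
  by (simp add: is_subfield_def)

lemma is_subfield_of_int:
  fixes K :: "'a::field set"
  assumes K: "is_subfield K"
  shows "of_int c \<in> K"
proof -
  have nat: "of_nat k \<in> K" for k
    by (induction k) (simp_all add: is_subfield_0[OF K] is_subfield_1[OF K] is_subfield_add[OF K])
  show ?thesis
  proof (cases c rule: int_cases2)
    case (nonneg k)
    then show ?thesis using nat[of k] by simp
  next
    case (nonpos k)
    then show ?thesis using is_subfield_neg[OF K nat[of k]] by simp
  qed
qed

lemma is_subfield_rat_adjoin: "is_subfield (rat_adjoin x)"
  unfolding rat_adjoin_def
  by (rule hull_in) (auto simp: is_subfield_def)

lemma rat_adjoin_self: "x \<in> rat_adjoin x"
  unfolding rat_adjoin_def by (rule hull_inc) simp

lemma rat_poly_eval_add: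
  "poly (map_poly of_rat (P + Q)) (x::'a::field_char_0) = poly (map_poly of_rat P) x + poly (map_poly of_rat Q) x"
  by (simp add: hom_distribs)

lemma rat_poly_eval_mult:
  "poly (map_poly of_rat (P * Q)) (x::'a::field_char_0) = poly (map_poly of_rat P) x * poly (map_poly of_rat Q) x"
proof -
  interpret map_poly_comm_ring_hom "of_rat :: rat \<Rightarrow> 'a" ..
  show ?thesis by (simp add: hom_mult)
qed

lemma rat_poly_eval_pCons:
  "poly (map_poly of_rat (pCons c P)) (x::'a::field_char_0) = of_rat c + x * poly (map_poly of_rat P) x"
  by (simp add: of_rat_hom.map_poly_pCons_hom)

lemma rat_poly_eval_int_comb:
  fixes M :: nat and x :: "'a::field_char_0"
  shows "poly (map_poly of_rat (\<Sum>j\<le>M. [:of_int (a j):] * P j)) x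
     = (\<Sum>j\<le>M. of_int (a j) * poly (map_poly of_rat (P j)) x)"
proof -
  have scale: "poly (map_poly of_rat ([:of_int c:] * Q)) x = of_int c * poly (map_poly of_rat Q) x" for c Q
    unfolding rat_poly_eval_mult by (simp add: rat_poly_eval_pCons)
  show ?thesis
  proof (induction M)
    case 0
    show ?case
      using scale[of "a 0" "P 0"] by (simp del: mult_pCons_left)
  next
    case (Suc M)
    then show ?case
      by (simp only: sum.atMost_Suc rat_poly_eval_add scale)
  qed
qed

text \<open>
  In a principal ideal domain an irreducible element generates a maximal ideal.
\<close>

lemma irreducible_poly_bezout:
  fixes q P :: "'a::field_gcd poly"
  assumes "irreducible q" "\<not> q dvd P"
  shows "\<exists>a b. a * q + b * P = 1"
proof -
  have "prime_elem q"
    using assms(1) by (rule field_poly_irreducible_imp_prime)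
  then have "gcd q P = 1"
    using assms(2) by (simp add: prime_elem_imp_coprime)
  then show ?thesis
    by (metis bezout_coefficients_fst_snd)
qed

text \<open>
  The values at \<open>x\<close> of rational polynomials already form a field: if \<open>q \<nmid> P\<close>, a Bezout identity
  \<open>a q + b P = 1\<close> evaluated at the root \<open>x\<close> of \<open>q\<close> exhibits \<open>b(x)\<close> as the inverse of \<open>P(x)\<close>.
\<close>

lemma rat_adjoin_subset_polys:
  fixes x :: "'a::field_char_0"
  assumes q: "irreducible q" "poly (map_poly of_rat q) x = 0"
  shows "rat_adjoin x \<subseteq> range (\<lambda>P. poly (map_poly of_rat P) x)"
proof -
  define E where "E = (\<lambda>P. poly (map_poly of_rat P) x)"
  have E_add: "E (P + Q) = E P + E Q" and E_mult: "E (P * Q) = E P * E Q" for P Q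
    by (simp_all add: E_def rat_poly_eval_add rat_poly_eval_mult)
  have E_0: "E 0 = 0" and E_1: "E 1 = 1" and E_X: "E [:0, 1:] = x"
    by (simp_all add: E_def map_poly_pCons)
  have E_q: "E q = 0"
    using q(2) by (simp add: E_def)
  have E_minus: "- E P = E (- P)" for P
  proof (rule minus_unique)
    show "E P + E (- P) = 0"
      using E_add[of P "- P"] E_0 by simp
  qed
  have E_inverse: "inverse (E P) \<in> range E" for P
  proof (cases "q dvd P")
    case True
    then obtain R where "P = q * R" by (rule dvdE)
    then have "inverse (E P) = E 0"
      by (simp add: E_mult E_q E_0)
    then show ?thesis by (metis rangeI)
  next
    case False
    then obtain a b where "a * q + b * P = 1"
      using irreducible_poly_bezout[OF q(1) False] by auto
    then have "E b * E P = 1"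
      using E_1 E_q by (metis E_add E_mult add_0 mult_zero_right)
    then have "inverse (E P) = E b"
      by (metis inverse_unique mult.commute)
    then show ?thesis by (metis rangeI)
  qed
  have "is_subfield (range E)"
    unfolding is_subfield_def
  proof (intro conjI ballI)
    show "0 \<in> range E" "1 \<in> range E"
      using E_0 E_1 by (metis rangeI)+
    fix y assume "y \<in> range E"
    then obtain P where y: "y = E P" by (rule rangeE)
    show "- y \<in> range E" "inverse y \<in> range E"
      unfolding y using E_minus E_inverse by (metis rangeI)+
    fix z assume "z \<in> range E"
    then obtain Q where z: "z = E Q" by (rule rangeE)
    show "y + z \<in> range E" "y * z \<in> range E"
      unfolding y z by (metis E_add E_mult rangeI)+
  qed
  moreover have "{x} \<subseteq> range E"
    using E_X by (metis insert_subset empty_subsetI rangeI)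
  ultimately have "rat_adjoin x \<subseteq> range E"
    unfolding rat_adjoin_def by (intro hull_minimal)
  then show ?thesis by (simp only: E_def)
qed

text \<open>
  Conjugate numbers satisfy the same polynomial equations over \<open>\<rat>\<close>, because those of \<open>x\<close> are the
  multiples of its minimal polynomial. This transports relations without constructing the isomorphism
  between the two number fields.
\<close>

lemma rat_poly_eval_transfer:
  fixes x :: "'a::field_char_0" and y :: "'b::field_char_0"
  assumes "is_minimal_poly q x" "is_minimal_poly q y" "poly (map_poly of_rat P) x = 0"
  shows "poly (map_poly of_rat P) y = 0"
proof -
  have "q dvd P"
  proof (rule ccontr)
    assume "\<not> q dvd P"
    moreover have "irreducible q"
      using assms(1) by (simp add: is_minimal_poly_def)
    ultimately obtain a b where "a * q + b * P = 1"
      using irreducible_poly_bezout[of q P] by auto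
    then have "poly (map_poly of_rat (a * q + b * P)) x = 1" by simp
    then show False
      using assms(1,3) by (simp add: rat_poly_eval_add rat_poly_eval_mult is_minimal_poly_def)
  qed
  then show ?thesis
    using assms(2) by (auto simp: dvd_def rat_poly_eval_mult is_minimal_poly_def)
qed

text \<open>
  Linear functionals over a subfield separate points from it. Zorn's lemma yields a \<open>K\<close>-subspace \<open>H \<supseteq> K\<close>
  that is maximal among those avoiding \<open>x\<close>. Maximality makes \<open>H\<close> a hyperplane complementary to the line
  \<open>K x\<close>, and \<open>\<phi>\<close> is the coordinate along \<open>x\<close>.
\<close>

lemma exists_separating_functional:
  fixes K :: "'a::field set"
  assumes K: "is_subfield K" and x: "x \<notin> K"
  shows "\<exists>\<phi>::'a \<Rightarrow> 'a. (\<forall>y z. \<phi> (y + z) = \<phi> y + \<phi> z) \<and> (\<forall>c\<in>K. \<forall>y. \<phi> (c * y) = c * \<phi> y)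
            \<and> \<phi> 1 = 0 \<and> \<phi> x = 1"
proof -
  note K0 = is_subfield_0[OF K] is_subfield_1[OF K]
  note Kadd = is_subfield_add[OF K] and Kmult = is_subfield_mult[OF K]
    and Kneg = is_subfield_neg[OF K] and Kinv = is_subfield_inverse[OF K]
  define \<A> where "\<A> = {H. (\<forall>y\<in>H. \<forall>z\<in>H. y + z \<in> H) \<and> (\<forall>c\<in>K. \<forall>y\<in>H. c * y \<in> H)
                            \<and> K \<subseteq> H \<and> x \<notin> H}"
  have "\<exists>H\<in>\<A>. \<forall>X\<in>\<A>. H \<subseteq> X \<longrightarrow> X = H"
  proof (rule subset_Zorn_nonempty)
    have "K \<in> \<A>"
      unfolding \<A>_def using x by (simp add: Kadd Kmult)
    then show "\<A> \<noteq> {}" by blast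
    fix \<C> assume ne: "\<C> \<noteq> {}" and chain: "subset.chain \<A> \<C>"
    have sub: "H \<in> \<A>" if "H \<in> \<C>" for H
      using chain that unfolding subset.chain_def by (rule subsetD[OF conjunct1])
    have "y + z \<in> \<Union>\<C>" if "y \<in> H" "H \<in> \<C>" "z \<in> H'" "H' \<in> \<C>" for y z H H'
    proof -
      have "H \<subseteq> H' \<or> H' \<subseteq> H"
        using chain that unfolding subset.chain_def by blast
      then obtain G where "G \<in> \<C>" "y \<in> G" "z \<in> G"
        using \<open>y \<in> H\<close> \<open>H \<in> \<C>\<close> \<open>z \<in> H'\<close> \<open>H' \<in> \<C>\<close> by blast
      then show ?thesis
        using sub[of G] unfolding \<A>_def by blast
    qed
    moreover have "c * y \<in> \<Union>\<C>" if "c \<in> K" "y \<in> \<Union>\<C>" for c y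
      using that sub unfolding \<A>_def by blast
    moreover have "K \<subseteq> \<Union>\<C>" "x \<notin> \<Union>\<C>"
      using ne sub unfolding \<A>_def by blast+
    ultimately show "\<Union>\<C> \<in> \<A>"
      unfolding \<A>_def by blast
  qed
  then obtain H where H: "H \<in> \<A>" and max: "\<And>X. X \<in> \<A> \<Longrightarrow> H \<subseteq> X \<Longrightarrow> X = H"
    by blast
  have Hadd: "\<And>y z. y \<in> H \<Longrightarrow> z \<in> H \<Longrightarrow> y + z \<in> H"
    and Hmult: "\<And>c y. c \<in> K \<Longrightarrow> y \<in> H \<Longrightarrow> c * y \<in> H"
    and KH: "K \<subseteq> H" and xH: "x \<notin> H"
    using H by (simp_all add: \<A>_def)
  have Hneg: "- y \<in> H" if "y \<in> H" for y
    using Hmult[OF Kneg[OF K0(2)] that] by simp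
  have decomp: "\<exists>c\<in>K. y - c * x \<in> H" for y
  proof (cases "y \<in> H")
    case True
    then show ?thesis using K0 by (intro bexI[of _ 0]) auto
  next
    case False
    \<comment> \<open>\<open>X = H + K y\<close> is strictly larger than \<open>H\<close>, so by maximality it contains \<open>x\<close>\<close>
    define X where "X = {h + c * y | h c. h \<in> H \<and> c \<in> K}"
    have XI: "h + c * y \<in> X" if "h \<in> H" "c \<in> K" for h c
      using that unfolding X_def by blast
    have "H \<subseteq> X"
    proof
      fix h assume "h \<in> H"
      then show "h \<in> X" using XI[of h 0] K0 by simp
    qed
    moreover have "y \<in> X"
      using XI[of 0 1] K0 KH by (simp add: subsetD)
    ultimately have "X \<notin> \<A>"
      using max False by blast
    moreover have "a + b \<in> X" if ab: "a \<in> X" "b \<in> X" for a b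
    proof -
      obtain h c h' c' where "a = h + c * y" "b = h' + c' * y" "h \<in> H" "h' \<in> H" "c \<in> K" "c' \<in> K"
        using ab unfolding X_def by blast
      then have "a + b = (h + h') + (c + c') * y" "h + h' \<in> H" "c + c' \<in> K"
        by (simp_all add: distrib_right Hadd Kadd add_ac)
      then show ?thesis by (simp only: XI)
    qed
    moreover have "d * a \<in> X" if da: "d \<in> K" "a \<in> X" for a d
    proof -
      obtain h c where "a = h + c * y" "h \<in> H" "c \<in> K"
        using da unfolding X_def by blast
      then have "d * a = d * h + (d * c) * y" "d * h \<in> H" "d * c \<in> K"
        using da by (simp_all add: distrib_left mult.assoc Hmult Kmult)
      then show ?thesis by (simp only: XI)
    qed
    moreover have "K \<subseteq> X"
      using KH \<open>H \<subseteq> X\<close> by blast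
    ultimately have "x \<in> X"
      unfolding \<A>_def by blast
    then obtain h c where hc: "x = h + c * y" "h \<in> H" "c \<in> K"
      unfolding X_def by blast
    then have "c \<noteq> 0"
      using xH by auto
    then have "y - inverse c * x = - inverse c * h"
      unfolding hc(1) by (simp add: field_simps)
    then show ?thesis
      using Hmult[OF Kneg[OF Kinv[OF hc(3)]] hc(2)] Kinv[OF hc(3)] by (intro bexI[of _ "inverse c"]) auto
  qed
  have unique: "c = d" if cd: "c \<in> K" "d \<in> K" "y - c * x \<in> H" "y - d * x \<in> H" for c d y
  proof (rule ccontr)
    assume "c \<noteq> d"
    have "(y - d * x) + - (y - c * x) \<in> H"
      using cd Hadd Hneg by blast
    moreover have "(y - d * x) + - (y - c * x) = (c - d) * x"
      by (simp add: algebra_simps)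
    moreover have "inverse (c - d) \<in> K"
      using Kinv[OF Kadd[OF cd(1) Kneg[OF cd(2)]]] by simp
    ultimately have "inverse (c - d) * ((c - d) * x) \<in> H"
      using Hmult by metis
    then show False
      using \<open>c \<noteq> d\<close> xH by (simp flip: mult.assoc)
  qed
  obtain \<phi> where \<phi>: "\<And>y. \<phi> y \<in> K" "\<And>y. y - \<phi> y * x \<in> H"
    using decomp by metis
  have \<phi>_eq: "\<phi> y = c" if "c \<in> K" "y - c * x \<in> H" for y c
    using unique[OF \<phi>(1) that(1) \<phi>(2) that(2)] .
  show ?thesis
  proof (intro exI[of _ \<phi>] conjI allI ballI)
    fix y z
    have "y + z - (\<phi> y + \<phi> z) * x = (y - \<phi> y * x) + (z - \<phi> z * x)"
      by (simp add: algebra_simps)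
    then have "y + z - (\<phi> y + \<phi> z) * x \<in> H"
      by (simp only: Hadd \<phi>(2))
    then show "\<phi> (y + z) = \<phi> y + \<phi> z"
      by (intro \<phi>_eq Kadd \<phi>(1))
  next
    fix c y assume c: "c \<in> K"
    have "c * y - c * \<phi> y * x = c * (y - \<phi> y * x)"
      by (simp add: algebra_simps)
    then have "c * y - c * \<phi> y * x \<in> H"
      by (simp only: Hmult c \<phi>(2))
    then show "\<phi> (c * y) = c * \<phi> y"
      by (intro \<phi>_eq Kmult c \<phi>(1))
  next
    show "\<phi> 1 = 0"
      using K0 KH by (intro \<phi>_eq) (simp_all add: subsetD)
    show "\<phi> x = 1"
      using K0 KH by (intro \<phi>_eq) (simp_all add: subsetD)
  qed
qed

section \<open>Eigenvalues of integer matrices\<close>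

text \<open>
  The characteristic polynomial of an integer matrix is monic with integer coefficients.
\<close>

lemma algebraic_int_eigenvalue:
  fixes A :: "nat \<Rightarrow> nat \<Rightarrow> int" and v :: "nat \<Rightarrow> 'a::field_char_0"
  assumes eig: "\<And>s. s < L \<Longrightarrow> \<delta> * v s = (\<Sum>t<L. of_int (A s t) * v t)"
    and nz: "k < L" "v k \<noteq> 0"
  shows "algebraic_int \<delta>"
proof -
  define M where "M = mat L L (\<lambda>(s, t). A s t)"
  let ?MR = "map_mat of_int M :: 'a mat"
  have carrier: "M \<in> carrier_mat L L" "?MR \<in> carrier_mat L L"
    by (auto simp: M_def)
  have "eigenvector ?MR (vec L v) \<delta>"
    unfolding eigenvector_def
  proof (intro conjI)
    show "vec L v \<noteq> 0\<^sub>v (dim_row ?MR)"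
      using nz carrier by (metis carrier_matD(1) index_vec index_zero_vec(1))
    show "?MR *\<^sub>v vec L v = \<delta> \<cdot>\<^sub>v vec L v"
      using carrier
      by (intro eq_vecI) (auto simp: M_def scalar_prod_def eig atLeast0LessThan intro!: sum.cong)
  qed (use carrier in auto)
  then have "poly (char_poly ?MR) \<delta> = 0"
    using eigenvalue_root_char_poly[OF carrier(2)] by (auto simp: eigenvalue_def)
  moreover have "char_poly ?MR = map_poly of_int (char_poly M)"
    by (rule of_int_hom.char_poly_hom[OF carrier(1)])
  moreover have "lead_coeff (char_poly M) = 1"
    using degree_monic_char_poly[OF carrier(1)] by simp
  ultimately show ?thesis
    unfolding algebraic_int_altdef_ipoly by auto
qed

section \<open>Digit weights\<close>

locale alternate_base_sequence =
  fixes p :: nat and \<beta> :: "nat \<Rightarrow> real"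
  assumes base: "alternate_base p \<beta>"
begin

definition \<delta> :: real where
  "\<delta> = (\<Prod>i=1..p. \<beta> i)"

text \<open>
  The contribution of a digit \<open>1\<close> at position \<open>n\<close> to the value of an expansion.
\<close>

definition w :: "nat \<Rightarrow> real" where
  "w n = inverse (\<Prod>i=1..n. \<beta> i)"

lemma p_pos: "p \<ge> 1"
  and base_gt_1: "n \<ge> 1 \<Longrightarrow> \<beta> n > 1"
  and base_add_p: "n \<ge> 1 \<Longrightarrow> \<beta> (n + p) = \<beta> n"
  using base by (auto simp: alternate_base_def)

lemma w_0 [simp]: "w 0 = 1"
  by (simp add: w_def)

lemma w_Suc: "w (Suc n) = w n / \<beta> (Suc n)"
  by (simp add: w_def field_simps)

lemma w_pos: "w n > 0"
proof -
  have "(\<Prod>i=1..n. \<beta> i) > 0"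
  proof (rule prod_pos)
    fix i assume "i \<in> {1..n}"
    then show "0 < \<beta> i" using base_gt_1[of i] by auto
  qed
  then show ?thesis by (simp add: w_def)
qed

lemma w_Suc_less: "w (Suc n) < w n"
  using w_pos[of n] base_gt_1[of "Suc n"] by (simp add: w_Suc divide_less_eq)

lemma w_strict_antimono: "m < n \<Longrightarrow> w n < w m"
  by (rule lift_Suc_mono_less[of "\<lambda>n. - w n", simplified]) (auto intro: w_Suc_less)

lemma w_antimono: "m \<le> n \<Longrightarrow> w n \<le> w m"
  using w_strict_antimono[of m n] by (cases "m = n") auto

lemma w_p: "w p = inverse \<delta>"
  by (simp add: w_def \<delta>_def)

lemma w_add_p: "w (n + p) = w n / \<delta>"
proof (induction n)
  case 0
  show ?case by (simp add: w_p inverse_eq_divide)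
next
  case (Suc n)
  then show ?case
    using base_add_p[of "Suc n"] by (simp add: w_Suc)
qed

lemma \<delta>_gt_1: "\<delta> > 1"
proof -
  have "inverse \<delta> < 1"
    using w_strict_antimono[of 0 p] p_pos by (simp add: w_p)
  moreover have "inverse \<delta> > 0"
    using w_pos[of p] by (simp add: w_p)
  ultimately show ?thesis
    by (simp add: inverse_less_1_iff)
qed

lemma w_add_periods: "w (k * p + n) = w n / \<delta> ^ k"
proof (induction k)
  case (Suc k)
  have "w (Suc k * p + n) = w ((k * p + n) + p)" by (simp add: algebra_simps)
  then show ?case using Suc by (simp add: w_add_p)
qed simp

lemma w_eventually_small:
  assumes "e > 0"
  shows "\<exists>k0. \<forall>k\<ge>k0. w (k * p) < e"
proof -
  obtain k0 where k0: "1 / e < \<delta> ^ k0"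
    using real_arch_pow[OF \<delta>_gt_1] by blast
  have "w (k * p) < e" if "k \<ge> k0" for k
  proof -
    have "\<delta> ^ k0 \<le> \<delta> ^ k"
      using that \<delta>_gt_1 by (intro power_increasing) auto
    then have "1 / e < \<delta> ^ k" using k0 by simp
    then have "1 / \<delta> ^ k < e"
      using assms \<delta>_gt_1 by (simp add: field_simps)
    then show ?thesis
      using w_add_periods[of k 0] by simp
  qed
  then show ?thesis by blast
qed

lemma w_small: "e > 0 \<Longrightarrow> \<exists>n\<ge>m. w n < e"
proof -
  assume "e > 0"
  then obtain k0 where k0: "\<And>k. k \<ge> k0 \<Longrightarrow> w (k * p) < e"
    using w_eventually_small by blast
  have "max k0 m * p \<ge> m"
    using p_pos by (metis max.cobounded2 mult.right_neutral mult_le_mono)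
  then show ?thesis using k0[of "max k0 m"] by auto
qed

lemma base_values: "n \<ge> 1 \<Longrightarrow> \<beta> n \<in> \<beta> ` {1..p}"
proof (induction n rule: less_induct)
  case (less n)
  show ?case
  proof (cases "n \<le> p")
    case False
    then show ?thesis
      using less.IH[of "n - p"] base_add_p[of "n - p"] p_pos by auto
  qed (use less.prems in auto)
qed

lemma base_bounded: "\<exists>D. \<forall>n\<ge>1. \<beta> n \<le> D"
proof -
  have "\<forall>n\<ge>1. \<beta> n \<le> Max (\<beta> ` {1..p})"
    using base_values by (auto intro!: Max_ge)
  then show ?thesis by blast
qed

section \<open>Greedy expansions and finiteness\<close>

abbreviation r :: "real \<Rightarrow> nat \<Rightarrow> real" where
  "r \<equiv> greedy_remainder \<beta>"

abbreviation d :: "real \<Rightarrow> nat \<Rightarrow> int" where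
  "d \<equiv> greedy_expansion \<beta>"

lemma remainder_Suc: "r x (Suc n) = \<beta> (Suc n) * r x n - of_int (d x (Suc n))"
  by (simp add: greedy_expansion_def)

lemma remainder_bounds:
  assumes "0 \<le> x" "x < 1"
  shows "0 \<le> r x n" "r x n < 1"
proof -
  have "0 \<le> r x n \<and> r x n < 1"
  proof (cases n)
    case (Suc m)
    show ?thesis
      unfolding Suc greedy_remainder.simps by linarith
  qed (use assms in auto)
  then show "0 \<le> r x n" "r x n < 1" by auto
qed

lemma digit_bounds:
  assumes "0 \<le> x" "x < 1" "n \<ge> 1"
  shows "0 \<le> d x n" "of_int (d x n) \<le> \<beta> n"
proof -
  have \<beta>: "\<beta> n > 1" using base_gt_1 assms by simp
  show "0 \<le> d x n"
    using remainder_bounds[OF assms(1,2), of "n - 1"] \<beta> by (simp add: greedy_expansion_def)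
  have "\<beta> n * r x (n - 1) \<le> \<beta> n * 1"
    using remainder_bounds[OF assms(1,2), of "n - 1"] \<beta> by (intro mult_left_mono) auto
  then show "of_int (d x n) \<le> \<beta> n"
    unfolding greedy_expansion_def by linarith
qed

lemma remainder_expansion:
  assumes "m \<le> n"
  shows "r x m * w m = (\<Sum>j=Suc m..n. of_int (d x j) * w j) + r x n * w n"
  using assms
proof (induction n rule: dec_induct)
  case (step n)
  have "r x n * w n = (\<beta> (Suc n) * r x n) * w (Suc n)"
    using base_gt_1[of "Suc n"] by (simp add: w_Suc)
  also have "\<beta> (Suc n) * r x n = of_int (d x (Suc n)) + r x (Suc n)"
    by (simp only: remainder_Suc)
  finally have "r x n * w n = of_int (d x (Suc n)) * w (Suc n) + r x (Suc n) * w (Suc n)"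
    by (simp only: distrib_right)
  then show ?case using step by simp
qed simp

text \<open>
  The remainder after \<open>m\<close> steps, measured in units of \<open>w m\<close>, is the part \<open>t\<close> of the number still to be
  expanded. While \<open>t\<close> is smaller than the current weight the digits are \<open>0\<close>, and only the unit changes.
\<close>

lemma remainder_carry:
  assumes "m \<le> n" "r y m = t / w m" "0 \<le> t" "t < w n"
  shows "r y n = t / w n"
  using assms
proof (induction n rule: dec_induct)
  case (step n)
  have "t < w n" using step.prems w_Suc_less[of n] by simp
  then have "\<beta> (Suc n) * r y n = t / w (Suc n)"
    using step by (simp add: w_Suc)
  moreover have "\<lfloor>t / w (Suc n)\<rfloor> = 0"
    using step.prems w_pos[of "Suc n"] by (simp add: floor_eq_iff)
  ultimately show ?case by simp
qed

lemma remainder_stays_0: "r x m = 0 \<Longrightarrow> m \<le> n \<Longrightarrow> r x n = 0"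
  using remainder_carry[of m n x 0] w_pos[of n] by simp

text \<open>
  If all digits after position \<open>m\<close> vanish, the amount \<open>r x m * w m\<close> still to be expanded equals
  \<open>r x n * w n < w n\<close> for every \<open>n \<ge> m\<close>, so it is \<open>0\<close>. Finiteness of the digit sequence thus becomes the
  termination of the algorithm, which is easier to propagate.
\<close>

lemma Fin_iff: "x \<in> Fin_base \<beta> \<longleftrightarrow> 0 \<le> x \<and> x < 1 \<and> (\<exists>n. r x n = 0)"
proof (cases "0 \<le> x \<and> x < 1")
  case x: True
  have "(\<exists>n. r x n = 0)" if "finite {n. n \<ge> 1 \<and> d x n \<noteq> 0}"
  proof -
    from that obtain m where m: "\<And>j. j > m \<Longrightarrow> d x j = 0"
      unfolding finite_nat_set_iff_bounded_le by (metis (mono_tags, lifting) leD less_one linorder_not_le mem_Collect_eq not_less0)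
    have "r x m = 0"
    proof (rule ccontr)
      assume "r x m \<noteq> 0"
      then have "r x m * w m > 0"
        using remainder_bounds[of x m] x w_pos[of m] by simp
      then obtain n where n: "n \<ge> m" "w n < r x m * w m"
        using w_small by blast
      have "r x m * w m = r x n * w n"
        using remainder_expansion[OF n(1), of x] m by simp
      also have "\<dots> \<le> 1 * w n"
        using remainder_bounds[of x n] x w_pos[of n] by (intro mult_right_mono) auto
      finally show False using n(2) by simp
    qed
    then show ?thesis ..
  qed
  moreover have "finite {n. n \<ge> 1 \<and> d x n \<noteq> 0}" if n: "r x n = 0" for n
  proof -
    have "d x j = 0" if "j > n" for j
      using remainder_stays_0[OF n, of "j - 1"] that by (simp add: greedy_expansion_def)
    then have "{n. n \<ge> 1 \<and> d x n \<noteq> 0} \<subseteq> {..n}"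
      using not_le_imp_less by blast
    then show ?thesis by (rule finite_subset) simp
  qed
  ultimately show ?thesis
    using x digit_bounds(1)[of x] by (auto simp: Fin_base_def finite_digit_seqs_def)
qed (auto simp: Fin_base_def)

lemma Fin_finite_sum:
  assumes "x \<in> Fin_base \<beta>"
  shows "\<exists>M. x = (\<Sum>j=1..M. of_int (d x j) * w j)"
proof -
  obtain M where "r x M = 0" using assms Fin_iff by blast
  then show ?thesis
    using remainder_expansion[of 0 M x] by (intro exI[of _ M]) simp
qed

lemma zero_in_Fin: "0 \<in> Fin_base \<beta>"
  unfolding Fin_iff by (auto intro: exI[of _ 0])

lemma w_in_Fin:
  assumes "n \<ge> 1"
  shows "w n \<in> Fin_base \<beta>"
proof -
  obtain m where m: "n = Suc m" using assms by (cases n) auto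
  have "r (w n) m = w n / w m"
    by (rule remainder_carry[of 0]) (use w_pos[of n] w_Suc_less m in auto)
  then have "\<beta> n * r (w n) m = 1"
    using w_pos[of m] base_gt_1[of n] by (simp add: m w_Suc)
  then have "r (w n) n = 0"
    by (simp add: m)
  then show ?thesis
    using w_strict_antimono[of 0 n] w_pos[of n] assms Fin_iff by (force intro: less_imp_le)
qed

section \<open>Relations between the weights from Property (PF)\<close>

lemma multiple_of_w_in_Fin:
  assumes PF: "property_PF \<beta>" and "n \<ge> 1" "of_nat k * w n < 1"
  shows "of_nat k * w n \<in> Fin_base \<beta>"
  using assms(3)
proof (induction k)
  case 0
  show ?case by (simp add: zero_in_Fin)
next
  case (Suc k)
  have *: "of_nat (Suc k) * w n = of_nat k * w n + w n"
    by (simp add: algebra_simps)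
  then have "of_nat k * w n \<in> Fin_base \<beta>"
    using Suc w_pos[of n] by simp
  then show ?case
    using PF w_in_Fin[OF assms(2)] Suc.prems w_pos[of n] unfolding * property_PF_def by simp
qed

text \<open>
  The source of all relations. With \<open>N\<close> the least integer such that \<open>y = N w\<^sub>n \<ge> w\<^sub>i\<close>, the excess \<open>y - w\<^sub>i\<close> is less
  than \<open>w\<^sub>n\<close>. The gap condition gives \<open>y < w\<^sub>i\<^sub>-\<^sub>1\<close>, so the expansion of \<open>y\<close> has its first nonzero digit at
  position \<open>i\<close>, that digit is \<open>1\<close>, and the excess reaches position \<open>n\<close> untouched. The remaining
  digits are finitely many by (PF), and bounded by the base.
\<close>

lemma leading_digit_expansion:
  assumes PF: "property_PF \<beta>" and i: "i \<ge> 1" "i < n" and gap: "w n < w (i - 1) - w i"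
  obtains N :: nat and M :: nat and x :: "nat \<Rightarrow> int"
  where "w i \<le> of_nat N * w n" "of_nat N * w n < w i + w n"
    and "of_nat N * w n = w i + (\<Sum>j=Suc n..M. of_int (x j) * w j)"
    and "\<forall>j\<ge>1. 0 \<le> x j \<and> of_int (x j) \<le> \<beta> j"
proof -
  define N where "N = nat \<lceil>w i / w n\<rceil>"
  define y where "y = of_nat N * w n"
  have "w i / w n > 0" using w_pos by simp
  then have "w i / w n \<le> of_nat N" "of_nat N < w i / w n + 1"
    unfolding N_def by linarith+
  then have y: "w i \<le> y" "y < w i + w n"
    using w_pos[of n] by (auto simp: y_def field_simps)
  have "w (i - 1) \<le> 1" using w_antimono[of 0 "i - 1"] by simp
  then have y1: "0 \<le> y" "y < 1"
    using y gap w_pos[of i] by auto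
  have "r y (i - 1) = y / w (i - 1)"
    by (rule remainder_carry[of 0]) (use y y1 gap in auto)
  then have "\<beta> i * r y (i - 1) = y / w i"
    using w_Suc[of "i - 1"] i by simp
  \<comment> \<open>\<open>y < w i + w n < 2 * w i\<close>, hence the digit at position \<open>i\<close> is \<open>1\<close>\<close>
  moreover have "\<lfloor>y / w i\<rfloor> = 1"
    using y w_strict_antimono[OF i(2)] w_pos[of i] by (simp add: floor_eq_iff field_simps)
  moreover have "r y i = \<beta> i * r y (i - 1) - of_int \<lfloor>\<beta> i * r y (i - 1)\<rfloor>"
    using i by (cases i) auto
  ultimately have "r y i = y / w i - 1"
    by simp
  then have "r y i = (y - w i) / w i"
    using w_pos[of i] by (simp add: diff_divide_distrib)
  then have rn: "r y n = (y - w i) / w n"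
    by (rule remainder_carry[rotated]) (use i y in auto)
  have "y \<in> Fin_base \<beta>"
    unfolding y_def by (rule multiple_of_w_in_Fin[OF PF]) (use i y1 in \<open>auto simp: y_def\<close>)
  then obtain M0 where "r y M0 = 0"
    using Fin_iff by blast
  then have "r y (max n M0) = 0"
    using remainder_stays_0 by (metis max.cobounded2)
  then have "r y n * w n = (\<Sum>j=Suc n..max n M0. of_int (d y j) * w j)"
    using remainder_expansion[of n "max n M0" y] by simp
  then have "y = w i + (\<Sum>j=Suc n..max n M0. of_int (d y j) * w j)"
    using rn w_pos[of n] by simp
  then show ?thesis
    using y digit_bounds[OF y1] unfolding y_def
    by (intro that[of N "d (of_nat N * w n)" "max n M0"]) simp_all
qed

lemma leading_digit_gap:
  assumes "i \<ge> 1"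
  shows "0 < w (i - 1) - w i"
  using w_Suc_less[of "i - 1"] assms by simp

section \<open>Integrality of the period product\<close>

definition int_span :: "nat set \<Rightarrow> real set" where
  "int_span T = range (\<lambda>a::nat \<Rightarrow> int. \<Sum>j\<in>T. of_int (a j) * w j)"

lemma int_spanI: "x = (\<Sum>j\<in>T. of_int (a j) * w j) \<Longrightarrow> x \<in> int_span T"
  unfolding int_span_def by blast

lemma int_span_0: "0 \<in> int_span T"
  by (rule int_spanI[of _ "\<lambda>_. 0"]) simp

lemma int_span_add: "x \<in> int_span T \<Longrightarrow> y \<in> int_span T \<Longrightarrow> x + y \<in> int_span T"
proof -
  assume "x \<in> int_span T" "y \<in> int_span T"
  then obtain a b :: "nat \<Rightarrow> int" where "x = (\<Sum>j\<in>T. of_int (a j) * w j)" "y = (\<Sum>j\<in>T. of_int (b j) * w j)"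
    unfolding int_span_def by blast
  then have "x + y = (\<Sum>j\<in>T. of_int (a j + b j) * w j)"
    by (simp add: sum.distrib algebra_simps)
  then show ?thesis by (rule int_spanI)
qed

lemma int_span_scale: "x \<in> int_span T \<Longrightarrow> of_int c * x \<in> int_span T"
proof -
  assume "x \<in> int_span T"
  then obtain a :: "nat \<Rightarrow> int" where "x = (\<Sum>j\<in>T. of_int (a j) * w j)"
    unfolding int_span_def by blast
  then have "of_int c * x = (\<Sum>j\<in>T. of_int (c * a j) * w j)"
    by (simp add: sum_distrib_left algebra_simps)
  then show ?thesis by (rule int_spanI)
qed

lemma int_span_sum: "(\<And>s. s \<in> S \<Longrightarrow> f s \<in> int_span T) \<Longrightarrow> (\<Sum>s\<in>S. f s) \<in> int_span T"
  by (induction S rule: infinite_finite_induct) (auto intro: int_span_0 int_span_add)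

lemma int_span_generator:
  assumes "finite T" "j \<in> T"
  shows "w j \<in> int_span T"
proof (rule int_spanI[of _ "\<lambda>i. if i = j then 1 else 0"])
  have "(\<Sum>i\<in>T. of_int (if i = j then 1 else 0) * w i) = (\<Sum>i\<in>T. if i = j then w i else 0)"
    by (intro sum.cong) auto
  then show "w j = (\<Sum>i\<in>T. of_int (if i = j then 1 else 0) * w i)"
    using assms by simp
qed

lemma int_span_subset:
  assumes "\<And>j. j \<in> T \<Longrightarrow> w j \<in> int_span T'" "x \<in> int_span T"
  shows "x \<in> int_span T'"
proof -
  obtain a :: "nat \<Rightarrow> int" where "x = (\<Sum>j\<in>T. of_int (a j) * w j)"
    using assms(2) unfolding int_span_def by blast
  then show ?thesis
    by (auto intro!: int_span_sum int_span_scale assms(1))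
qed

lemma int_span_add_p:
  assumes "x \<in> int_span {Suc m..m + L}"
  shows "x / \<delta> \<in> int_span {Suc (m + p)..m + p + L}"
proof -
  obtain a :: "nat \<Rightarrow> int" where "x = (\<Sum>j=Suc m..m + L. of_int (a j) * w j)"
    using assms unfolding int_span_def by blast
  then have "x / \<delta> = (\<Sum>j=Suc m..m + L. of_int (a (j + p - p)) * w (j + p))"
    by (simp add: w_add_p sum_divide_distrib)
  also have "\<dots> = (\<Sum>j=Suc m + p..m + L + p. of_int (a (j - p)) * w j)"
    by (rule sum.shift_bounds_cl_nat_ivl[symmetric])
  finally show ?thesis
    by (intro int_spanI[of _ "\<lambda>j. a (j - p)"]) (simp add: algebra_simps)
qed

text \<open>
  Solve the relation of \<open>leading_digit_expansion\<close> for \<open>w\<^sub>i\<close>; all its other terms have larger indices.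
\<close>

lemma w_in_span_of_later:
  assumes PF: "property_PF \<beta>" and i: "i \<ge> 1"
  shows "\<exists>L. w i \<in> int_span {Suc i..i + L}"
proof -
  obtain n where n: "n \<ge> Suc i" "w n < w (i - 1) - w i"
    using w_small[OF leading_digit_gap[OF i]] by blast
  then obtain N M x where "of_nat N * w n = w i + (\<Sum>j=Suc n..M. of_int (x j) * w j)"
    using leading_digit_expansion[OF PF i, of n] by (metis Suc_le_lessD)
  then have eq: "w i = of_int (int N) * w n + (\<Sum>j=Suc n..M. of_int (- x j) * w j)"
    by (simp add: sum_negf)
  have gen: "w j \<in> int_span {Suc i..i + max n M}" if "n \<le> j" "j \<le> max n M" for j
    using n that by (intro int_span_generator) auto
  have "w i \<in> int_span {Suc i..i + max n M}"
    unfolding eq by (intro int_span_add int_span_scale int_span_sum gen) auto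
  then show ?thesis ..
qed

text \<open>
  The bound is uniform because dividing a relation by \<open>\<delta>\<close> shifts all its indices by \<open>p\<close>, so only the
  indices \<open>1, \<dots>, p\<close> have to be treated.
\<close>

lemma w_in_span_of_later_uniform:
  assumes PF: "property_PF \<beta>"
  obtains L where "L \<ge> 1" "\<And>i. i \<ge> 1 \<Longrightarrow> w i \<in> int_span {Suc i..i + L}"
proof -
  have "\<forall>i. \<exists>L. i \<ge> 1 \<longrightarrow> w i \<in> int_span {Suc i..i + L}"
    using w_in_span_of_later[OF PF] by blast
  then obtain f where f: "\<And>i. i \<ge> 1 \<Longrightarrow> w i \<in> int_span {Suc i..i + f i}"
    by metis
  define L where "L = Suc (\<Sum>i=1..p. f i)"
  have "w i \<in> int_span {Suc i..i + L}" if "i \<ge> 1" for i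
    using that
  proof (induction i rule: less_induct)
    case (less i)
    show ?case
    proof (cases "i \<le> p")
      case True
      then have "f i \<le> L"
        using member_le_sum[of i "{1..p}" f] less.prems by (simp add: L_def)
      then show ?thesis
        by (intro int_span_subset[OF int_span_generator f]) (use less.prems in auto)
    next
      case False
      then have "w i = w (i - p) / \<delta>" "i = (i - p) + p"
        using w_add_p[of "i - p"] by auto
      moreover have "w (i - p) \<in> int_span {Suc (i - p)..i - p + L}"
        using False p_pos less.prems by (intro less.IH) auto
      ultimately show ?thesis
        using int_span_add_p[of "w (i - p)" "i - p" L] by simp
    qed
  qed
  then show ?thesis using that[of L] by (simp add: L_def)
qed

text \<open>
  Downward induction on the index: replacing a weight in front of the window by the \<open>L\<close> following ones
  never passes the end of the window.
\<close>

lemma w_in_span_of_window: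
  assumes L: "\<And>i. i \<ge> 1 \<Longrightarrow> w i \<in> int_span {Suc i..i + L}"
    and "1 \<le> i" "i \<le> m + L"
  shows "w i \<in> int_span {Suc m..m + L}"
  using assms(2,3)
proof (induction "m + L - i" arbitrary: i rule: less_induct)
  case less
  show ?case
  proof (cases "i \<le> m")
    case True
    show ?thesis
      by (rule int_span_subset[OF _ L[OF less.prems(1)]]) (use True less in auto)
  qed (use less.prems in \<open>auto intro: int_span_generator\<close>)
qed

text \<open>
  The window starts after position \<open>p\<close>, so that \<open>\<delta> * w (p + 1 + s) = w (1 + s)\<close> still has a positive
  index, as the relations require.
\<close>

lemma \<delta>_multiplication_matrix:
  assumes PF: "property_PF \<beta>"
  obtains L and A :: "nat \<Rightarrow> nat \<Rightarrow> int" where "L \<ge> 1"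
    "\<And>s. s < L \<Longrightarrow> \<delta> * w (Suc p + s) = (\<Sum>t<L. of_int (A s t) * w (Suc p + t))"
proof -
  obtain L where L1: "L \<ge> 1" and L: "\<And>i. i \<ge> 1 \<Longrightarrow> w i \<in> int_span {Suc i..i + L}"
    using w_in_span_of_later_uniform[OF PF] by blast
  have "\<exists>a::nat \<Rightarrow> int. \<delta> * w (Suc p + s) = (\<Sum>t<L. of_int (a t) * w (Suc p + t))" if "s < L" for s
  proof -
    have "\<delta> * w (Suc p + s) = w (Suc s)"
      using w_add_p[of "Suc s"] \<delta>_gt_1 by (simp add: add.commute)
    moreover have "w (Suc s) \<in> int_span {Suc p..p + L}"
      using that by (intro w_in_span_of_window[OF L]) auto
    ultimately obtain a :: "nat \<Rightarrow> int"
      where "\<delta> * w (Suc p + s) = (\<Sum>j=Suc p..p + L. of_int (a j) * w j)"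
      unfolding int_span_def by auto
    also have "\<dots> = (\<Sum>t<L. of_int (a (Suc p + t)) * w (Suc p + t))"
      by (rule sum.reindex_bij_witness[of _ "\<lambda>t. Suc p + t" "\<lambda>j. j - Suc p"]) auto
    finally show ?thesis by (rule exI[of _ "\<lambda>t. a (Suc p + t)"])
  qed
  then have "\<forall>s. \<exists>a::nat \<Rightarrow> int. s < L \<longrightarrow> \<delta> * w (Suc p + s) = (\<Sum>t<L. of_int (a t) * w (Suc p + t))"
    by blast
  then obtain A :: "nat \<Rightarrow> nat \<Rightarrow> int"
    where "\<And>s. s < L \<Longrightarrow> \<delta> * w (Suc p + s) = (\<Sum>t<L. of_int (A s t) * w (Suc p + t))"
    by metis
  then show ?thesis using that L1 by blast
qed

lemma algebraic_int_\<delta>: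
  assumes PF: "property_PF \<beta>"
  shows "algebraic_int \<delta>"
proof -
  obtain L and A :: "nat \<Rightarrow> nat \<Rightarrow> int" where L: "L \<ge> 1"
    and A: "\<And>s. s < L \<Longrightarrow> \<delta> * w (Suc p + s) = (\<Sum>t<L. of_int (A s t) * w (Suc p + t))"
    using \<delta>_multiplication_matrix[OF PF] by blast
  show ?thesis
  proof (rule algebraic_int_eigenvalue)
    show "\<And>s. s < L \<Longrightarrow> \<delta> * w (Suc p + s) = (\<Sum>t<L. of_int (A s t) * w (Suc p + t))"
      by (fact A)
    show "0 < L" using L by simp
    show "w (Suc p + 0) \<noteq> 0" using w_pos[of "Suc p + 0"] by simp
  qed
qed

section \<open>Comparison with other solutions of the relations\<close>

text \<open>
  Such a \<open>v\<close> is the restriction to the weights of an additive map on the group that they generate; stating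
  this by relations covers both linear functionals and conjugation.
\<close>

definition respects_relations :: "(nat \<Rightarrow> complex) \<Rightarrow> bool" where
  "respects_relations v \<longleftrightarrow>
     (\<forall>(a::nat \<Rightarrow> int) M. (\<Sum>j\<le>M. of_int (a j) * w j) = 0 \<longrightarrow> (\<Sum>j\<le>M. of_int (a j) * v j) = 0)"

text \<open>
  Brings the relations of \<open>leading_digit_expansion\<close> into the form of a single integer combination.
\<close>

lemma transfer_relation:
  assumes v: "respects_relations v" and "i < n"
    and rel: "of_nat N * w n = w i + (\<Sum>j=Suc n..M. of_int (x j) * w j)"
  shows "of_nat N * v n = v i + (\<Sum>j=Suc n..M. of_int (x j) * v j)"
proof -
  define a where "a j = (if j = n then int N else 0) - (if j = i then 1 else 0)
                          - (if j \<in> {Suc n..M} then x j else 0)" for j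
  have expand: "(\<Sum>j\<le>max n M. of_int (a j) * g j) = of_nat N * g n - g i - (\<Sum>j=Suc n..M. of_int (x j) * g j)"
    for g :: "nat \<Rightarrow> 'b::comm_ring_1"
  proof -
    have "of_int (a j) * g j = (if j = n then of_nat N * g n else 0) - (if j = i then g i else 0)
            - (if j \<in> {Suc n..M} then of_int (x j) * g j else 0)" for j
      by (simp add: a_def algebra_simps)
    then have "(\<Sum>j\<le>max n M. of_int (a j) * g j) =
        (\<Sum>j\<le>max n M. if j = n then of_nat N * g n else 0) - (\<Sum>j\<le>max n M. if j = i then g i else 0)
          - (\<Sum>j\<le>max n M. if j \<in> {Suc n..M} then of_int (x j) * g j else 0)"
      by (simp only: sum_subtractf)
    also have "(\<Sum>j\<le>max n M. if j = n then of_nat N * g n else 0) = of_nat N * g n"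
      by simp
    also have "(\<Sum>j\<le>max n M. if j = i then g i else 0) = g i"
      using \<open>i < n\<close> by simp
    also have "(\<Sum>j\<le>max n M. if j \<in> {Suc n..M} then of_int (x j) * g j else 0)
        = (\<Sum>j\<in>{..max n M} \<inter> {Suc n..M}. of_int (x j) * g j)"
      by (rule sum.inter_restrict[symmetric]) simp
    also have "{..max n M} \<inter> {Suc n..M} = {Suc n..M}" by auto
    finally show ?thesis .
  qed
  have "(\<Sum>j\<le>max n M. of_int (a j) * w j) = 0"
    unfolding expand using rel by simp
  then have "(\<Sum>j\<le>max n M. of_int (a j) * v j) = 0"
    using v unfolding respects_relations_def by blast
  then show ?thesis
    unfolding expand by (simp add: algebra_simps)
qed

lemma scaled_add_periods:
  fixes v :: "nat \<Rightarrow> complex"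
  assumes "\<And>n. v (n + p) = v n / \<gamma>"
  shows "v (k * p + n) = v n / \<gamma> ^ k"
proof (induction k)
  case (Suc k)
  have "v (Suc k * p + n) = v ((k * p + n) + p)" by (simp add: algebra_simps)
  also have "\<dots> = v (k * p + n) / \<gamma>" by (rule assms)
  finally show ?case using Suc by simp
qed simp

text \<open>
  The partial sums \<open>S\<close> satisfy \<open>S n \<le> S (n + p) = S p + S n / |\<gamma>|\<close>.
\<close>

lemma scaled_partial_sums_bounded:
  fixes v :: "nat \<Rightarrow> complex"
  assumes scale: "\<And>n. v (n + p) = v n / \<gamma>" and \<gamma>: "norm \<gamma> > 1"
  shows "\<exists>B. \<forall>n. (\<Sum>s<n. norm (v s)) \<le> B"
proof -
  define S where "S n = (\<Sum>s<n. norm (v s))" for n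
  have "S n \<le> S p / (1 - 1 / norm \<gamma>)" for n
  proof -
    have "S n \<le> S (n + p)"
      unfolding S_def by (rule sum_mono2) auto
    also have "S (n + p) = S p + (\<Sum>s<n. norm (v (s + p)))"
    proof (induction n)
      case (Suc n)
      then show ?case by (simp add: S_def)
    qed simp
    also have "(\<Sum>s<n. norm (v (s + p))) = S n / norm \<gamma>"
      by (simp add: S_def scale norm_divide sum_divide_distrib)
    finally have "S n * (1 - 1 / norm \<gamma>) \<le> S p"
      by (simp add: algebra_simps)
    moreover have "1 / norm \<gamma> < 1"
      using \<gamma> by (subst divide_less_eq_1_pos) auto
    ultimately show ?thesis
      by (simp add: pos_le_divide_eq)
  qed
  then show ?thesis unfolding S_def by blast
qed

lemma rounding_error:
  fixes a q N :: real
  assumes "0 < q" "a \<le> N / q" "N / q < a + 1 / q"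
  shows "\<bar>N - a * q\<bar> \<le> 1"
proof -
  have "a * q \<le> N"
    using assms(1,2) by (simp only: pos_le_divide_eq)
  moreover have "N / q < (a * q + 1) / q"
    using assms(1,3) by (simp add: add_divide_distrib)
  then have "N < a * q + 1"
    using assms(1) by (simp only: divide_less_cancel)
  ultimately show ?thesis by simp
qed

text \<open>
  With \<open>n = kp\<close> the integer \<open>N\<close> of \<open>leading_digit_expansion\<close> differs from \<open>w\<^sub>i \<delta>\<^sup>k\<close> by at most \<open>1\<close>, since
  \<open>w\<^sub>n = \<delta>\<^sup>-\<^sup>k\<close>. The same relation for \<open>v\<close>, multiplied by \<open>\<gamma>\<^sup>k\<close>, expresses \<open>N v\<^sub>0\<close> as \<open>v\<^sub>i \<gamma>\<^sup>k\<close> plus a sum of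
  initial terms of \<open>v\<close> with bounded coefficients, and the terms of \<open>v\<close> are absolutely summable because
  \<open>|\<gamma>| > 1\<close>.
\<close>

lemma leading_terms_agree:
  assumes PF: "property_PF \<beta>" and v: "respects_relations v"
    and scale: "\<And>n. v (n + p) = v n / \<gamma>" and \<gamma>: "norm \<gamma> > 1" and i: "i \<ge> 1"
  shows "\<exists>C k0. \<forall>k\<ge>k0. norm (v i * \<gamma> ^ k - of_real (w i * \<delta> ^ k) * v 0) \<le> C"
proof -
  obtain D where D: "\<And>n. n \<ge> 1 \<Longrightarrow> \<beta> n \<le> D"
    using base_bounded by blast
  obtain B where B: "\<And>n. (\<Sum>s<n. norm (v s)) \<le> B"
    using scaled_partial_sums_bounded[where v = v and \<gamma> = \<gamma>, OF scale \<gamma>] by blast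
  obtain k1 where k1: "\<And>k. k \<ge> k1 \<Longrightarrow> w (k * p) < w (i - 1) - w i"
    using w_eventually_small[OF leading_digit_gap[OF i]] by blast
  have D0: "D \<ge> 0" using D[of 1] base_gt_1[of 1] by simp
  have "norm (v i * \<gamma> ^ k - of_real (w i * \<delta> ^ k) * v 0) \<le> norm (v 0) + D * B"
    if k: "k \<ge> max k1 (Suc i)" for k
  proof -
    define n where "n = k * p"
    have "k \<le> n" using p_pos by (simp add: n_def)
    then have "i < n" using k by simp
    have "w n < w (i - 1) - w i" using k1 k by (simp add: n_def)
    obtain N M x where N: "w i \<le> of_nat N * w n" "of_nat N * w n < w i + w n"
      and rel: "of_nat N * w n = w i + (\<Sum>j=Suc n..M. of_int (x j) * w j)"
      and x: "\<forall>j\<ge>1. 0 \<le> x j \<and> of_int (x j) \<le> \<beta> j"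
      by (rule leading_digit_expansion[OF PF i \<open>i < n\<close> \<open>w n < w (i - 1) - w i\<close>])
    have \<gamma>0: "\<gamma> \<noteq> 0" using \<gamma> by auto
    have vn: "v (n + s) = v s / \<gamma> ^ k" for s
      unfolding n_def by (rule scaled_add_periods[where v = v and \<gamma> = \<gamma>, OF scale])
    have wn: "w n = 1 / \<delta> ^ k"
      using w_add_periods[of k 0] by (simp add: n_def)

    \<comment> \<open>the tail of the relation after multiplication by \<open>\<gamma> ^ k\<close>\<close>
    define T where "T = (\<Sum>j=Suc n..M. of_int (x j) * v (j - n))"
    have "(\<Sum>j=Suc n..M. of_int (x j) * v j) = T / \<gamma> ^ k"
      unfolding T_def sum_divide_distrib
    proof (rule sum.cong)
      fix j assume "j \<in> {Suc n..M}"
      then show "of_int (x j) * v j = of_int (x j) * v (j - n) / \<gamma> ^ k"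
        using vn[of "j - n"] by simp
    qed simp
    moreover have "v n = v 0 / \<gamma> ^ k"
      using vn[of 0] by simp
    ultimately have "of_nat N * (v 0 / \<gamma> ^ k) = v i + T / \<gamma> ^ k"
      using transfer_relation[OF v \<open>i < n\<close> rel] by metis
    then have "(of_nat N * (v 0 / \<gamma> ^ k)) * \<gamma> ^ k = (v i + T / \<gamma> ^ k) * \<gamma> ^ k"
      by (rule arg_cong)
    then have "of_nat N * v 0 = v i * \<gamma> ^ k + T"
      using \<gamma>0 by (simp add: distrib_right)
    \<comment> \<open>the rounding error made when \<open>N\<close> was chosen\<close>
    moreover define e where "e = of_nat N - w i * \<delta> ^ k"
    then have "(of_nat N :: complex) = of_real (w i * \<delta> ^ k) + of_real e"
      by simp
    ultimately have "(of_real (w i * \<delta> ^ k) + of_real e) * v 0 = v i * \<gamma> ^ k + T"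
      by simp
    then have "of_real (w i * \<delta> ^ k) * v 0 + of_real e * v 0 = v i * \<gamma> ^ k + T"
      by (simp only: distrib_right)
    moreover have "b - c = d - t" if "c + d = b + t" for b c d t :: complex
      using that by (simp add: diff_eq_eq eq_diff_eq algebra_simps)
    ultimately have eq: "v i * \<gamma> ^ k - of_real (w i * \<delta> ^ k) * v 0 = of_real e * v 0 - T"
      by (simp only:)
    have e: "\<bar>e\<bar> \<le> 1"
      unfolding e_def
    proof (rule rounding_error)
      show "0 < \<delta> ^ k" using \<delta>_gt_1 by simp
      show "w i \<le> of_nat N / \<delta> ^ k" "of_nat N / \<delta> ^ k < w i + 1 / \<delta> ^ k"
        using N unfolding wn by simp_all
    qed
    have "norm T \<le> (\<Sum>j=Suc n..M. D * norm (v (j - n)))"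
      unfolding T_def
    proof (rule sum_norm_le)
      fix j assume "j \<in> {Suc n..M}"
      then have "j \<ge> 1" by simp
      then have "0 \<le> x j" "of_int (x j) \<le> \<beta> j" "\<beta> j \<le> D"
        using x D[of j] by blast+
      then have "0 \<le> x j" "of_int (x j) \<le> D" by simp_all
      then show "norm (of_int (x j) * v (j - n)) \<le> D * norm (v (j - n))"
        by (simp add: norm_mult mult_right_mono)
    qed
    also have "\<dots> = D * (\<Sum>j=Suc n..M. norm (v (j - n)))"
      by (simp add: sum_distrib_left)
    also have "(\<Sum>j=Suc n..M. norm (v (j - n))) = (\<Sum>s=1..M - n. norm (v s))"
      by (rule sum.reindex_bij_witness[of _ "\<lambda>s. s + n" "\<lambda>j. j - n"]) auto
    also have "\<dots> \<le> (\<Sum>s<Suc (M - n). norm (v s))"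
      by (rule sum_mono2) auto
    also have "\<dots> \<le> B" by (rule B)
    finally have "norm T \<le> D * B"
      using D0 by (simp add: mult_left_mono)
    moreover have "norm (of_real e * v 0) \<le> norm (v 0)"
      using e mult_right_mono[of "\<bar>e\<bar>" 1 "norm (v 0)"] by (simp add: norm_mult)
    moreover have "norm (of_real e * v 0 - T) \<le> norm (of_real e * v 0) + norm T"
      by (rule norm_triangle_ineq4)
    ultimately show ?thesis
      unfolding eq by linarith
  qed
  then show ?thesis by blast
qed

lemma power_\<delta>_unbounded: "\<exists>k\<ge>k0. \<delta> ^ k > C"
proof -
  obtain k where "C < \<delta> ^ k"
    using real_arch_pow[OF \<delta>_gt_1] by blast
  also have "\<dots> \<le> \<delta> ^ max k0 k"
    using \<delta>_gt_1 by (intro power_increasing) auto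
  finally show ?thesis by (intro exI[of _ "max k0 k"]) simp
qed

lemma power_\<delta>_multiple_bounded_imp_0:
  assumes "\<And>k. k \<ge> k0 \<Longrightarrow> \<delta> ^ k * c \<le> C" "c \<ge> 0"
  shows "c = 0"
proof (rule ccontr)
  assume "c \<noteq> 0"
  then have "c > 0" using assms(2) by simp
  obtain k where "k \<ge> k0" "\<delta> ^ k > C / c"
    using power_\<delta>_unbounded by blast
  then show False
    using assms(1)[of k] \<open>c > 0\<close> by (simp add: field_simps)
qed

lemma \<delta>_solution_proportional:
  assumes PF: "property_PF \<beta>" and v: "respects_relations v"
    and scale: "\<And>n. v (n + p) = v n / of_real \<delta>" and i: "i \<ge> 1"
  shows "v i = of_real (w i) * v 0"
proof -
  have "norm (of_real \<delta> :: complex) > 1" using \<delta>_gt_1 by simp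
  then obtain C k0 where C: "\<And>k. k \<ge> k0 \<Longrightarrow>
      norm (v i * of_real \<delta> ^ k - of_real (w i * \<delta> ^ k) * v 0) \<le> C"
    using leading_terms_agree[OF PF v scale _ i] by blast
  have "norm (v i - of_real (w i) * v 0) = 0"
  proof (rule power_\<delta>_multiple_bounded_imp_0)
    fix k assume "k \<ge> k0"
    have "v i * of_real \<delta> ^ k - of_real (w i * \<delta> ^ k) * v 0 = of_real (\<delta> ^ k) * (v i - of_real (w i) * v 0)"
      by (simp add: algebra_simps)
    then show "\<delta> ^ k * norm (v i - of_real (w i) * v 0) \<le> C"
      using C[OF \<open>k \<ge> k0\<close>] \<delta>_gt_1 by (simp add: norm_mult norm_power)
  qed simp
  then show ?thesis by simp
qed

text \<open>
  For \<open>i = p\<close> the comparison says that \<open>a\<^sub>k = \<gamma>\<^sup>k - \<delta>\<^sup>k\<close> is bounded. Then so is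
  \<open>a\<^sub>k\<^sub>+\<^sub>1 - \<gamma> a\<^sub>k = \<delta>\<^sup>k (\<gamma> - \<delta>)\<close>, although \<open>\<delta>\<^sup>k\<close> is not. This avoids comparing \<open>|\<gamma>|\<close> with \<open>\<delta>\<close>.
\<close>

lemma expanding_solution_is_\<delta>:
  assumes PF: "property_PF \<beta>" and v: "respects_relations v"
    and scale: "\<And>n. v (n + p) = v n / \<gamma>" and \<gamma>: "norm \<gamma> > 1" and v0: "v 0 = 1"
  shows "\<gamma> = of_real \<delta>"
proof -
  obtain C k0 where C: "\<And>k. k \<ge> k0 \<Longrightarrow> norm (v p * \<gamma> ^ k - of_real (w p * \<delta> ^ k) * v 0) \<le> C"
    using leading_terms_agree[OF PF v scale \<gamma> p_pos] by blast
  have \<gamma>0: "\<gamma> \<noteq> 0" using \<gamma> by auto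
  have vp: "v p = 1 / \<gamma>" using scale[of 0] v0 by simp
  define a where "a k = \<gamma> ^ k - of_real \<delta> ^ k" for k
  have a: "norm (a k) \<le> C" if "k \<ge> k0" for k
  proof -
    have "v p * \<gamma> ^ Suc k - of_real (w p * \<delta> ^ Suc k) * v 0 = a k"
      using \<gamma>0 \<delta>_gt_1 by (simp add: a_def vp v0 w_p)
    then show ?thesis using C[of "Suc k"] that by simp
  qed
  have "norm (\<gamma> - of_real \<delta>) = 0"
  proof (rule power_\<delta>_multiple_bounded_imp_0)
    fix k assume k: "k \<ge> k0"
    have "of_real (\<delta> ^ k) * (\<gamma> - of_real \<delta>) = a (Suc k) - \<gamma> * a k"
      by (simp add: a_def algebra_simps)
    moreover have "norm (of_real (\<delta> ^ k) * (\<gamma> - of_real \<delta>)) = \<delta> ^ k * norm (\<gamma> - of_real \<delta>)"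
      using \<delta>_gt_1 by (simp add: norm_mult norm_power)
    ultimately have "\<delta> ^ k * norm (\<gamma> - of_real \<delta>) = norm (a (Suc k) - \<gamma> * a k)"
      by (simp only:)
    also have "\<dots> \<le> norm (a (Suc k)) + norm (\<gamma> * a k)"
      by (rule norm_triangle_ineq4)
    also have "norm (\<gamma> * a k) = norm \<gamma> * norm (a k)"
      by (rule norm_mult)
    also have "norm (a (Suc k)) + norm \<gamma> * norm (a k) \<le> C + norm \<gamma> * C"
      using a k by (intro add_mono mult_left_mono) auto
    finally show "\<delta> ^ k * norm (\<gamma> - of_real \<delta>) \<le> C + norm \<gamma> * C" .
  qed simp
  then show ?thesis by simp
qed

section \<open>The base lies in the field generated by the period product\<close>

text \<open>
  A \<open>\<rat>(\<delta>)\<close>-linear functional \<open>\<phi>\<close> preserves the integer relations and the scaling by \<open>\<delta>\<close>, so the weights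
  satisfy \<open>\<phi>(w\<^sub>i) = w\<^sub>i \<phi>(1)\<close>. A functional that vanishes on \<open>1\<close> but not on \<open>w\<^sub>i\<close> is therefore impossible.
\<close>

lemma w_in_rat_adjoin:
  assumes PF: "property_PF \<beta>"
  shows "w i \<in> rat_adjoin \<delta>"
proof (cases "i = 0")
  case True
  then show ?thesis using is_subfield_1[OF is_subfield_rat_adjoin] by simp
next
  case False
  let ?K = "rat_adjoin \<delta>"
  have K: "is_subfield ?K" by (rule is_subfield_rat_adjoin)
  show ?thesis
  proof (rule ccontr)
    assume "w i \<notin> ?K"
    then obtain \<phi> :: "real \<Rightarrow> real" where add: "\<And>y z. \<phi> (y + z) = \<phi> y + \<phi> z"
      and mult: "\<And>c y. c \<in> ?K \<Longrightarrow> \<phi> (c * y) = c * \<phi> y"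
      and \<phi>1: "\<phi> 1 = 0" and \<phi>i: "\<phi> (w i) = 1"
      using exists_separating_functional[OF K] by blast
    define v where "v n = complex_of_real (\<phi> (w n))" for n
    have comb: "\<phi> (\<Sum>j\<le>M. of_int (a j) * w j) = (\<Sum>j\<le>M. of_int (a j) * \<phi> (w j))"
      for a :: "nat \<Rightarrow> int" and M
      by (induction M) (simp_all add: add mult is_subfield_of_int[OF K] del: w_0)
    have \<phi>0: "\<phi> 0 = 0" using add[of 0 0] by simp
    have "respects_relations v"
      unfolding respects_relations_def
    proof (intro allI impI)
      fix a :: "nat \<Rightarrow> int" and M assume "(\<Sum>j\<le>M. of_int (a j) * w j) = 0"
      then have "(\<Sum>j\<le>M. of_int (a j) * \<phi> (w j)) = 0"
        using comb[of a M] \<phi>0 by simp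
      then have "complex_of_real (\<Sum>j\<le>M. of_int (a j) * \<phi> (w j)) = 0"
        by simp
      then show "(\<Sum>j\<le>M. of_int (a j) * v j) = 0"
        by (simp add: v_def)
    qed
    moreover have "v (n + p) = v n / of_real \<delta>" for n
    proof -
      have "inverse \<delta> \<in> ?K"
        by (rule is_subfield_inverse[OF K rat_adjoin_self])
      then have "\<phi> (inverse \<delta> * w n) = inverse \<delta> * \<phi> (w n)"
        by (rule mult)
      then show ?thesis
        by (simp add: v_def w_add_p divide_inverse mult.commute)
    qed
    ultimately have "v i = of_real (w i) * v 0"
      using False by (intro \<delta>_solution_proportional[OF PF]) simp_all
    then show False
      by (simp add: v_def \<phi>1 \<phi>i)
  qed
qed

lemma base_in_rat_adjoin:
  assumes PF: "property_PF \<beta>" and "i \<ge> 1"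
  shows "\<beta> i \<in> rat_adjoin \<delta>"
proof -
  have "w (i - 1) * inverse (w i) \<in> rat_adjoin \<delta>"
    using is_subfield_rat_adjoin w_in_rat_adjoin[OF PF]
    by (intro is_subfield_mult is_subfield_inverse)
  moreover have "w i = w (i - 1) / \<beta> i"
    using w_Suc[of "i - 1"] \<open>i \<ge> 1\<close> by simp
  then have "w (i - 1) * inverse (w i) = \<beta> i"
    using w_pos[of "i - 1"] by simp
  ultimately show ?thesis by simp
qed

section \<open>Conjugates of the period product\<close>

text \<open>
  Write \<open>w\<^sub>n = P\<^sub>n(\<delta>)\<close> with rational polynomials. The conjugates \<open>P\<^sub>n(\<gamma>)\<close> satisfy the same relations as the
  weights, with \<open>\<gamma>\<close> in place of \<open>\<delta>\<close>.
\<close>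

lemma conjugate_in_closed_disc:
  assumes PF: "property_PF \<beta>" and conj: "Galois_conjugate \<delta> \<gamma>" and ne: "\<gamma> \<noteq> of_real \<delta>"
  shows "norm \<gamma> \<le> 1"
proof (rule ccontr)
  assume "\<not> norm \<gamma> \<le> 1"
  then have \<gamma>: "norm \<gamma> > 1" by simp
  then have \<gamma>0: "\<gamma> \<noteq> 0" by auto
  obtain q where q\<delta>: "is_minimal_poly q \<delta>" and q\<gamma>: "is_minimal_poly q \<gamma>"
    using conj unfolding Galois_conjugate_def by blast
  have "w n \<in> range (\<lambda>P. poly (map_poly of_rat P) \<delta>)" for n
    using rat_adjoin_subset_polys[of q \<delta>] w_in_rat_adjoin[OF PF] q\<delta>
    unfolding is_minimal_poly_def by blast
  then have "\<forall>n. \<exists>P. w n = poly (map_poly of_rat P) \<delta>"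
    by (simp add: image_iff)
  then obtain P where P: "\<And>n. w n = poly (map_poly of_rat (P n)) \<delta>"
    by metis
  define v where "v n = poly (map_poly of_rat (P n)) \<gamma>" for n
  have transfer: "poly (map_poly of_rat Q) \<gamma> = 0" if "poly (map_poly of_rat Q) \<delta> = 0" for Q
    by (rule rat_poly_eval_transfer[OF q\<delta> q\<gamma> that])
  have "respects_relations v"
    unfolding respects_relations_def
  proof (intro allI impI)
    fix a :: "nat \<Rightarrow> int" and M assume "(\<Sum>j\<le>M. of_int (a j) * w j) = 0"
    then have "poly (map_poly of_rat (\<Sum>j\<le>M. [:of_int (a j):] * P j)) \<delta> = 0"
      unfolding rat_poly_eval_int_comb by (simp only: P)
    then have "poly (map_poly of_rat (\<Sum>j\<le>M. [:of_int (a j):] * P j)) \<gamma> = 0"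
      by (rule transfer)
    then show "(\<Sum>j\<le>M. of_int (a j) * v j) = 0"
      unfolding rat_poly_eval_int_comb by (simp only: v_def)
  qed
  moreover have "v (n + p) = v n / \<gamma>" for n
  proof -
    let ?Q = "[:0, 1:] * P (n + p) + [:-1:] * P n"
    have eval: "poly (map_poly of_rat ?Q) x = x * poly (map_poly of_rat (P (n + p))) x - poly (map_poly of_rat (P n)) x"
      for x :: "'b::field_char_0"
      unfolding rat_poly_eval_add rat_poly_eval_mult by (simp add: rat_poly_eval_pCons)
    have "\<delta> * w (n + p) - w n = 0"
      using \<delta>_gt_1 by (simp add: w_add_p)
    then have "poly (map_poly of_rat ?Q) \<delta> = 0"
      unfolding eval by (simp only: P)
    then have "poly (map_poly of_rat ?Q) \<gamma> = 0"
      by (rule transfer)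
    then have "\<gamma> * v (n + p) = v n"
      unfolding eval by (simp add: v_def)
    then show ?thesis
      using \<gamma>0 by (simp add: nonzero_eq_divide_eq mult.commute)
  qed
  moreover have "v 0 = 1"
  proof -
    have eval: "poly (map_poly of_rat (P 0 + [:-1:])) x = poly (map_poly of_rat (P 0)) x - 1" for x :: "'b::field_char_0"
      unfolding rat_poly_eval_add by (simp add: rat_poly_eval_pCons)
    have "poly (map_poly of_rat (P 0 + [:-1:])) \<delta> = 0"
      unfolding eval using P[of 0] by simp
    then have "poly (map_poly of_rat (P 0 + [:-1:])) \<gamma> = 0"
      by (rule transfer)
    then show ?thesis
      unfolding eval by (simp add: v_def)
  qed
  ultimately have "\<gamma> = of_real \<delta>"
    using \<gamma> by (intro expanding_solution_is_\<delta>[OF PF])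
  then show False using ne by simp
qed

lemma Pisot_or_Salem:
  assumes PF: "property_PF \<beta>"
  shows "Pisot_number \<delta> \<or> Salem_number \<delta>"
proof (cases "\<exists>\<gamma>. Galois_conjugate \<delta> \<gamma> \<and> \<gamma> \<noteq> complex_of_real \<delta> \<and> norm \<gamma> = 1")
  case True
  then show ?thesis
    unfolding Salem_number_def
    using algebraic_int_\<delta>[OF PF] \<delta>_gt_1 conjugate_in_closed_disc[OF PF] by blast
next
  case False
  then show ?thesis
    unfolding Pisot_number_def
    using algebraic_int_\<delta>[OF PF] \<delta>_gt_1 conjugate_in_closed_disc[OF PF]
    by (metis order_le_less)
qed

section \<open>Consequences of Property (F)\<close>

lemma F_imp_PF: "property_F \<beta> \<Longrightarrow> property_PF \<beta>"
  unfolding property_F_def property_PF_def by blast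

text \<open>
  The remainder of \<open>1\<close> after one step in the base shifted to \<open>\<beta>\<^sub>l\<close> is \<open>\<beta>\<^sub>l - \<lfloor>\<beta>\<^sub>l\<rfloor>\<close>. As \<open>1\<close> is not below \<open>1\<close>,
  the step is carried out one period further down in the original base: the number
  \<open>z = w\<^sub>n - \<lfloor>\<beta>\<^sub>l\<rfloor> w\<^sub>n\<^sub>+\<^sub>1\<close> with \<open>n \<equiv> l - 1\<close> modulo \<open>p\<close> has the same remainder after \<open>n + 1\<close> steps, and (F)
  makes its expansion finite.
\<close>

lemma simple_Parry_if_F:
  assumes F: "property_F \<beta>"
  shows "simple_Parry_base p \<beta>"
  unfolding simple_Parry_base_def
proof
  fix l assume l: "l \<in> {1..p}"
  \<comment> \<open>adding \<open>p\<close> ensures \<open>n \<ge> 1\<close> even for \<open>l = 1\<close>, so that \<open>w n < 1\<close>\<close>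
  define n where "n = p + l - 1"
  have n1: "n \<ge> 1" and Sn: "Suc n = l + p" using l by (auto simp: n_def)
  have \<beta>n: "\<beta> (Suc n) = \<beta> l" using base_add_p[of l] l Sn by simp
  define m where "m = nat \<lfloor>\<beta> l\<rfloor>"
  have \<beta>l: "\<beta> l > 1" using base_gt_1 l by simp
  then have m: "of_nat m = of_int \<lfloor>\<beta> l\<rfloor>" by (simp add: m_def)
  have m_bounds: "of_nat m \<le> \<beta> l" "\<beta> l < of_nat m + 1"
    unfolding m by linarith+
  have wn: "w n = \<beta> l * w (Suc n)"
    using \<beta>l by (simp add: w_Suc \<beta>n)
  have wn1: "w n < 1" using w_strict_antimono[of 0 n] n1 by simp
  define z where "z = w n - of_nat m * w (Suc n)"
  have z: "z = (\<beta> l - of_nat m) * w (Suc n)"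
    by (simp add: z_def wn algebra_simps)
  have z0: "0 \<le> z" using m_bounds w_pos[of "Suc n"] by (simp add: z)
  have "z \<le> w n" using w_pos[of "Suc n"] by (simp add: z_def)
  then have z1: "z < 1" using wn1 by simp
  have "of_nat m * w (Suc n) < 1" using z0 wn1 by (simp add: z_def)
  then have "of_nat m * w (Suc n) \<in> Fin_base \<beta>"
    using F by (intro multiple_of_w_in_Fin F_imp_PF) auto
  then have "z \<in> Fin_base \<beta>"
    using F w_in_Fin[OF n1] z0 z1 unfolding property_F_def z_def by simp
  then obtain M where M: "r z M = 0" using Fin_iff by blast
  let ?r = "greedy_remainder (shifted_base \<beta> l) 1"
  have "r z (Suc n) = z / w (Suc n)"
  proof (rule remainder_carry[of 0])
    show "z < w (Suc n)"
      using m_bounds w_pos[of "Suc n"] unfolding z by simp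
  qed (use z0 in simp_all)
  then have start: "r z (Suc n) = \<beta> l - of_nat m"
    using w_pos[of "Suc n"] by (simp add: z)
  have shift: "?r (Suc k) = r z (Suc n + k)" for k
  proof (induction k)
    case 0
    show ?case
      by (simp only: greedy_remainder.simps(2)[of "shifted_base \<beta> l"] greedy_remainder.simps(1) add_0_right start m)
        (simp add: shifted_base_def)
  next
    case (Suc k)
    have "shifted_base \<beta> l (Suc (Suc k)) = \<beta> (Suc (Suc n + k))"
      using base_add_p[of "Suc k + l"] Sn by (simp add: shifted_base_def add_ac)
    then show ?case
      by (simp only: add_Suc_right Suc greedy_remainder.simps(2)[of "shifted_base \<beta> l" 1 "Suc k"]
          greedy_remainder.simps(2)[of \<beta> z "Suc n + k"])
  qed
  have nonneg: "0 \<le> ?r k" for k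
    using shift[of "k - 1"] remainder_bounds(1)[OF z0 z1] by (cases k) auto
  have zero: "?r k = 0" if "k > M" for k
  proof -
    have "r z (Suc n + (k - 1)) = 0"
      using that by (intro remainder_stays_0[OF M]) simp
    then show ?thesis using shift[of "k - 1"] that by simp
  qed
  have digit: "greedy_expansion (shifted_base \<beta> l) 1 j = \<lfloor>\<beta> (j + l - 1) * ?r (j - 1)\<rfloor>" for j
    by (simp add: greedy_expansion_def shifted_base_def)
  have "0 \<le> greedy_expansion (shifted_base \<beta> l) 1 j" if "j \<ge> 1" for j
  proof -
    have "j + l - 1 \<ge> 1" using that l unfolding atLeastAtMost_iff by linarith
    then have "\<beta> (j + l - 1) > 1" by (rule base_gt_1)
    then have "0 \<le> \<beta> (j + l - 1) * ?r (j - 1)"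
      using nonneg by (intro mult_nonneg_nonneg) simp_all
    then show ?thesis unfolding digit by simp
  qed
  moreover have "{j. j \<ge> 1 \<and> greedy_expansion (shifted_base \<beta> l) 1 j \<noteq> 0} \<subseteq> {..Suc M}"
  proof
    fix j assume "j \<in> {j. j \<ge> 1 \<and> greedy_expansion (shifted_base \<beta> l) 1 j \<noteq> 0}"
    then have "?r (j - 1) \<noteq> 0" unfolding digit by auto
    then have "\<not> j - 1 > M" using zero by blast
    then show "j \<in> {..Suc M}" by simp
  qed
  then have "finite {j. j \<ge> 1 \<and> greedy_expansion (shifted_base \<beta> l) 1 j \<noteq> 0}"
    by (rule finite_subset) simp
  ultimately show "greedy_expansion (shifted_base \<beta> l) 1 \<in> finite_digit_seqs"
    unfolding finite_digit_seqs_def by blast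
qed

text \<open>
  By (F) the positive number \<open>w\<^sub>p - w\<^sub>2\<^sub>p\<close> is a sum of weights with non-negative integer coefficients. If \<open>\<psi>\<close>
  is positive on the base, it is positive on all weights, so \<open>\<psi>(w\<^sub>p) > \<psi>(w\<^sub>2\<^sub>p)\<close>. But
  \<open>\<psi>(w\<^sub>p) = \<psi>(w\<^sub>2\<^sub>p) \<psi>(\<delta>)\<close> and \<open>|\<psi>(\<delta>)| \<le> 1\<close>.
\<close>

lemma embedding_not_positive_if_F:
  assumes F: "property_F \<beta>" and emb: "embedding_of \<delta> \<psi>" and ne: "\<psi> \<delta> \<noteq> of_real \<delta>"
  shows "\<not> positive_vector p (\<lambda>i. \<psi> (\<beta> i))"
proof
  assume pos: "positive_vector p (\<lambda>i. \<psi> (\<beta> i))"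
  have PF: "property_PF \<beta>" by (rule F_imp_PF[OF F])
  let ?K = "rat_adjoin \<delta>"
  have K: "is_subfield ?K" by (rule is_subfield_rat_adjoin)
  have conj: "Galois_conjugate \<delta> (\<psi> \<delta>)" and \<psi>1: "\<psi> 1 = 1"
    and hom: "\<forall>x\<in>?K. \<forall>y\<in>?K. \<psi> (x + y) = \<psi> x + \<psi> y \<and> \<psi> (x * y) = \<psi> x * \<psi> y"
    using emb unfolding embedding_of_def field_iso_on_def by blast+
  have \<psi>add: "\<psi> (x + y) = \<psi> x + \<psi> y" and \<psi>mult: "\<psi> (x * y) = \<psi> x * \<psi> y"
    if "x \<in> ?K" "y \<in> ?K" for x y
    using hom that by blast+
  have wK: "w n \<in> ?K" for n by (rule w_in_rat_adjoin[OF PF])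
  have \<psi>0: "\<psi> 0 = 0" using \<psi>add[of 0 0] is_subfield_0[OF K] by simp
  have nwK: "of_nat k * w j \<in> ?K" for k j
    using is_subfield_mult[OF K is_subfield_of_int[OF K, of "int k"] wK[of j]] by simp
  have \<psi>nat: "\<psi> (of_nat k * w j) = of_nat k * \<psi> (w j)" for k j
  proof (induction k)
    case (Suc k)
    have "of_nat (Suc k) * w j = of_nat k * w j + w j"
      by (simp add: distrib_right)
    then have "\<psi> (of_nat (Suc k) * w j) = \<psi> (of_nat k * w j) + \<psi> (w j)"
      using \<psi>add[OF nwK wK] by simp
    then show ?case using Suc by (simp add: distrib_right)
  qed (simp add: \<psi>0)
  have \<psi>sum: "(\<Sum>j=1..M. of_nat (c j) * w j) \<in> ?K \<and>
      \<psi> (\<Sum>j=1..M. of_nat (c j) * w j) = (\<Sum>j=1..M. of_nat (c j) * \<psi> (w j))" for c :: "nat \<Rightarrow> nat" and M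
  proof (induction M)
    case (Suc M)
    then show ?case
      using is_subfield_add[OF K _ nwK] \<psi>add[OF _ nwK] \<psi>nat by simp
  qed (simp add: \<psi>0 is_subfield_0[OF K])
  have "\<exists>t>0. \<psi> (w n) = complex_of_real t" for n
  proof (induction n)
    case 0
    show ?case by (rule exI[of _ 1]) (simp add: \<psi>1)
  next
    case (Suc n)
    then obtain t where t: "t > 0" "\<psi> (w n) = of_real t" by blast
    obtain i where i: "i \<in> {1..p}" "\<beta> (Suc n) = \<beta> i" using base_values[of "Suc n"] by auto
    then obtain b where b: "b > 0" "\<psi> (\<beta> (Suc n)) = of_real b"
      using pos unfolding positive_vector_def by metis
    have "w n = w (Suc n) * \<beta> (Suc n)"
      using base_gt_1[of "Suc n"] by (simp add: w_Suc)
    then have "\<psi> (w n) = \<psi> (w (Suc n)) * \<psi> (\<beta> (Suc n))"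
      using \<psi>mult[OF wK base_in_rat_adjoin[OF PF]] by simp
    then have "\<psi> (w (Suc n)) = of_real (t / b)"
      using t b by (simp add: field_simps)
    then show ?case using t b by (intro exI[of _ "t / b"]) simp
  qed
  then obtain t where t0: "\<And>n. t n > 0" and t: "\<And>n. \<psi> (w n) = complex_of_real (t n)"
    by metis
  have \<delta>w: "\<psi> (w n) = \<psi> (w (n + p)) * \<psi> \<delta>" for n
  proof -
    have "w n = w (n + p) * \<delta>" using \<delta>_gt_1 by (simp add: w_add_p)
    then show ?thesis using \<psi>mult[OF wK rat_adjoin_self] by simp
  qed
  have "norm (\<psi> \<delta>) \<le> 1" by (rule conjugate_in_closed_disc[OF PF conj ne])
  have "t p \<le> t (p + p)"
  proof -
    have "norm (\<psi> (w p)) \<le> norm (\<psi> (w (p + p))) * 1"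
      unfolding \<delta>w[of p] norm_mult using \<open>norm (\<psi> \<delta>) \<le> 1\<close> by (intro mult_left_mono) auto
    then show ?thesis using t0[of p] t0[of "p + p"] by (simp add: t)
  qed
  define z where "z = w p - w (p + p)"
  have z0: "z > 0" using w_strict_antimono[of p "p + p"] p_pos by (simp add: z_def)
  have "z < 1" using w_pos[of "p + p"] w_antimono[of 0 p] by (simp add: z_def)
  then have zFin: "z \<in> Fin_base \<beta>"
    using F w_in_Fin[of p] w_in_Fin[of "p + p"] p_pos z0 unfolding property_F_def z_def by simp
  obtain M where M: "z = (\<Sum>j=1..M. of_int (d z j) * w j)"
    using Fin_finite_sum[OF zFin] by blast
  define c where "c j = nat (d z j)" for j
  have "(\<Sum>j=1..M. of_int (d z j) * w j) = (\<Sum>j=1..M. of_nat (c j) * w j)"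
  proof (rule sum.cong)
    fix j assume "j \<in> {1..M}"
    then have "0 \<le> d z j" using digit_bounds(1)[of z j] z0 \<open>z < 1\<close> by simp
    then show "of_int (d z j) * w j = of_nat (c j) * w j" by (simp add: c_def)
  qed simp
  then have zc: "z = (\<Sum>j=1..M. of_nat (c j) * w j)" using M by simp
  have \<psi>z: "z \<in> ?K" "\<psi> z = (\<Sum>j=1..M. of_nat (c j) * \<psi> (w j))"
    using \<psi>sum[of c M] unfolding zc[symmetric] by blast+
  have "\<psi> z = of_real (\<Sum>j=1..M. of_nat (c j) * t j)"
    using \<psi>z by (simp add: t)
  moreover have "\<psi> (w p) = \<psi> z + \<psi> (w (p + p))"
    using \<psi>add[of z "w (p + p)"] \<psi>z wK[of "p + p"] by (simp add: z_def)
  ultimately have "complex_of_real (t p) = of_real ((\<Sum>j=1..M. of_nat (c j) * t j) + t (p + p))"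
    by (simp add: t)
  then have "t p = (\<Sum>j=1..M. of_nat (c j) * t j) + t (p + p)"
    by (simp only: of_real_eq_iff)
  then have "(\<Sum>j=1..M. of_nat (c j) * t j) \<le> 0"
    using \<open>t p \<le> t (p + p)\<close> by simp
  moreover have nonneg: "of_nat (c j) * t j \<ge> 0" for j
    using t0[of j] by simp
  ultimately have "(\<Sum>j=1..M. of_nat (c j) * t j) = 0"
    by (meson antisym sum_nonneg)
  then have "of_nat (c j) * t j = 0" if "j \<in> {1..M}" for j
    using that nonneg by (simp add: sum_nonneg_eq_0_iff)
  then have "c j = 0" if "j \<in> {1..M}" for j
    using that t0[of j] by fastforce
  then have "z = 0" by (simp add: zc)
  then show False using z0 by simp
qed

end

theorem theorem3p1:
  fixes \<beta> :: "nat \<Rightarrow> real" and p :: nat and \<delta> :: real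
  assumes "alternate_base p \<beta>"
    and "\<delta> = (\<Prod>i=1..p. \<beta> i)"
  shows "(property_PF \<beta> \<longrightarrow>
            (Pisot_number \<delta> \<or> Salem_number \<delta>) \<and> (\<forall>i\<in>{1..p}. \<beta> i \<in> rat_adjoin \<delta>)) \<and>
         (property_F \<beta> \<longrightarrow>
            simple_Parry_base p \<beta> \<and>
            (\<forall>\<psi>. embedding_of \<delta> \<psi> \<and> \<psi> \<delta> \<noteq> complex_of_real \<delta> \<longrightarrow>
                  \<not> positive_vector p (\<lambda>i. \<psi> (\<beta> i))))"
proof -
  interpret B: alternate_base_sequence p \<beta>
    by unfold_locales (fact assms(1))
  have \<delta>: "\<delta> = B.\<delta>" by (simp add: assms(2) B.\<delta>_def)
  show ?thesis
    unfolding \<delta>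
    using B.Pisot_or_Salem B.base_in_rat_adjoin B.simple_Parry_if_F B.embedding_not_positive_if_F
    by auto
qed

end
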